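(* Let $h\in\mathfrak F$ (the class defined in the context) and suppose that $h$ is not $\phi$-cohomologous to a constant in $L^2(\mu)$, where $\phi$ is the Boolean-type transformation of $\mathbb{R}$ and $\mu$ its invariant Cauchy probability measure. Then $\widetilde\sigma^2\in(0,\infty)$ and, for every $x\in\mathbb{R}$, $$\mu\left(\frac{\widetilde S_n(h)-n\,\mu(h)}{\widetilde\sigma\sqrt n}\le x\right)-\mathfrak{N}(x)=o(1)\qquad\text{as } n\to\infty .$$
   Context: $\phi:\mathbb{R}\to\mathbb{R}$ is given by $\phi(x)=\frac12\left(x-\frac1x\right)$ for $x\ne0$ and $\phi(0)=0$. The probability measure $\mu$ with $d\mu(x)=\frac{1}{\pi(x^2+1)}\,dx$ is $\phi$-invariant. $\mathfrak F$ is the class of functions $h:\mathbb{R}\to\mathbb{R}$ whose left and right derivatives $h'(x-),h'(x+)$ exist everywhere and for which there exist $u,v\ge0$ with $u(2+v)<1$ and a constant $K>0$ such that for all $x\in\mathbb{R}$, $|h(x)|\le K(1+|x|)^u$ and $\max\{|h'(x-)|,|h'(x+)|\}\le K(1+|x|)^v$. Notation: $\widetilde S_n(h)=\sum_{k=0}^{n-1}h\circ\phi^k$; $\mu(h)=\int h\,d\mu$; $\widetilde\sigma^2=\lim_{n\to\infty}\int\big(\frac{\widetilde S_n(h)-n\mu(h)}{\sqrt n}\big)^2d\mu$, $\widetilde\sigma\ge 0$; $\mathfrak{N}(x)=\int_{-\infty}^x\frac{1}{\sqrt{2\pi}}e^{-y^2/2}\,dy$. $h$ is $\phi$-cohomologous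 to a constant in $L^2(\mu)$ if $h=\ell\circ\phi-\ell+c$ for some $\ell\in L^2(\mu)$ and constant $c$. *)

theory Defs
  imports "HOL-Probability.Probability"
begin

definition boole_map :: "real \<Rightarrow> real" where
  "boole_map x = (if x = 0 then 0 else (x - 1 / x) / 2)"

definition cauchy_measure :: "real measure" where
  "cauchy_measure = density lborel (\<lambda>x. ennreal (1 / (pi * (x\<^sup>2 + 1))))"

text \<open>The class of functions \<open>h\<close> with one-sided derivatives everywhere; \<open>l\<close> and \<open>r\<close> below
  are the (unique) left and right derivatives of \<open>h\<close> at \<open>x\<close>.\<close>

definition boole_class :: "(real \<Rightarrow> real) set" where
  "boole_class = {h. \<exists>u v K. 0 \<le> u \<and> 0 \<le> v \<and> u * (2 + v) < 1 \<and> 0 < K \<and>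
     (\<forall>x. \<bar>h x\<bar> \<le> K * (1 + \<bar>x\<bar>) powr u \<and>
       (\<exists>l r. (h has_real_derivative l) (at_left x) \<and>
              (h has_real_derivative r) (at_right x) \<and>
              max \<bar>l\<bar> \<bar>r\<bar> \<le> K * (1 + \<bar>x\<bar>) powr v))}"

definition birkhoff_sum :: "nat \<Rightarrow> (real \<Rightarrow> real) \<Rightarrow> real \<Rightarrow> real" where
  "birkhoff_sum n h x = (\<Sum>k<n. h ((boole_map ^^ k) x))"

definition cauchy_mean :: "(real \<Rightarrow> real) \<Rightarrow> real" where
  "cauchy_mean h = (\<integral>x. h x \<partial>cauchy_measure)"

definition normalized_variance :: "(real \<Rightarrow> real) \<Rightarrow> nat \<Rightarrow> real" where
  "normalized_variance h n =
     (\<integral>x. ((birkhoff_sum n h x - real n * cauchy_mean h) / sqrt (real n))\<^sup>2 \<partial>cauchy_measure)"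

text \<open>\<^const>\<open>lim\<close> is unspecified for divergent sequences, so statements about the following two
  constants must also establish convergence of \<^const>\<open>normalized_variance\<close>.\<close>

definition asymptotic_variance :: "(real \<Rightarrow> real) \<Rightarrow> real" where
  "asymptotic_variance h = lim (normalized_variance h)"

definition asymptotic_sd :: "(real \<Rightarrow> real) \<Rightarrow> real" where
  "asymptotic_sd h = sqrt (asymptotic_variance h)"

text \<open>Equality in \<open>L\<^sup>2\<close> is equality almost everywhere.\<close>

definition cohomologous_to_constant :: "(real \<Rightarrow> real) \<Rightarrow> bool" where
  "cohomologous_to_constant h \<longleftrightarrow>
     (\<exists>l c. l \<in> borel_measurable cauchy_measure \<and>
            integrable cauchy_measure (\<lambda>x. (l x)\<^sup>2) \<and>
            (AE x in cauchy_measure. h x = l (boole_map x) - l x + c))"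

definition std_normal_cdf :: "real \<Rightarrow> real" where
  "std_normal_cdf x = (LBINT y:{..x}. 1 / sqrt (2 * pi) * exp (- y\<^sup>2 / 2))"

end

theory Submission
  imports Defs "HOL-Real_Asymp.Real_Asymp"
begin

text \<open>In the coordinate \<open>arctan x\<close> the Boole map is angle doubling: its two inverse branches
  \<open>x \<plusminus> sqrt (x\<^sup>2 + 1)\<close> halve arctan-distances and carry equal weight under the Cauchy measure. Hence
  the transfer operator \<open>L\<close> (averaging over the two branches) contracts arctan-Lipschitz seminorms
  by \<open>1/2\<close>. Clamping \<open>h\<close> at an exponentially growing level shows that \<open>L\<^sup>n (h - \<mu>(h))\<close> decays
  geometrically in \<open>L\<^sup>2\<close>. So (Gordin)
  \<open>h - \<mu>(h) = m + g \<circ> \<phi> - g\<close> with \<open>g = \<Sum> L\<^sup>n (h - \<mu>(h))\<close> (over \<open>n \<ge> 1\<close>) square integrable and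
  \<open>L m = 0\<close>, and \<open>m \<noteq> 0\<close> because \<open>h\<close> is not cohomologous to a constant.

  For the reverse martingale difference \<open>m\<close> the characteristic function \<open>c\<^sub>j\<close> of
  \<open>s (m + \<dots> + m \<circ> \<phi>\<^sup>j\<^sup>-\<^sup>1)\<close> nearly satisfies \<open>c\<^sub>j\<^sub>+\<^sub>1 = (1 - s\<^sup>2 \<sigma>\<^sup>2 / 2) c\<^sub>j\<close>; the error is
  governed by \<open>w = L (m\<^sup>2) - \<sigma>\<^sup>2\<close> integrated against a slowly varying phase, and it vanishes because
  \<open>L\<^sup>p w\<close> tends to \<open>0\<close> in \<open>L\<^sup>1\<close>.\<close>

section \<open>Elementary estimates\<close>

text \<open>The Boole map is two-to-one, so the terms \<open>m ((T ^^ k) x)\<close> are martingale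
  differences only when time is read backwards. This is why Birkhoff sums are split at the front, as
  m + S o T: the duality between T and the transfer operator then integrates out the first term, and
  the characteristic functions satisfy a recursion in n. Mixing enters twice, at different
  strengths. Summing the series for g takes a geometric L2 rate, which has to be extracted from the
  growth conditions on h: in the coordinate arctan x the slope of h may grow like |x| to the power v
  + 2, and h may be unbounded, so h is in general not Lipschitz there; hence the clamping. The
  function w, in contrast, is built from m^2, and m is known only to be square integrable. So w is
  merely integrable and only decay without a rate is at hand; it is proved for every integrable
  function of mean zero, starting from indicators of half-lines.\<close>

lemma norm_telescope_geometric:
  fixes z :: "nat \<Rightarrow> 'a::real_normed_field"
  assumes "norm q \<le> 1" "z 0 = 1"
  shows "norm (z n - q ^ n) \<le> (\<Sum>j<n. norm (z (Suc j) - q * z j))"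
proof (induction n)
  case (Suc n)
  \<comment> \<open>The old error is multiplied by q, of norm at most 1, so one-step errors add up
    and are never amplified.\<close>
  have "norm (z (Suc n) - q ^ Suc n) = norm ((z (Suc n) - q * z n) + q * (z n - q ^ n))"
    by (simp add: algebra_simps)
  also have "\<dots> \<le> norm (z (Suc n) - q * z n) + norm (z n - q ^ n)"
    using assms(1) by (intro order_trans[OF norm_triangle_ineq] add_left_mono)
      (auto simp: norm_mult intro: mult_left_le_one_le)
  finally show ?case using Suc by simp
qed (simp add: assms)

text \<open>Both entries of the minimum matter: with m only square integrable, y^2 supplies the
  integrable majorant, while the cubic entry carries the extra factor |s| that makes the minimum
  vanish pointwise as s tends to 0. The common factor s^2 compensates for n steps when s = t / sqrt
  n.\<close>

lemma iexp_quadratic_remainder: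
  "cmod (iexp (s * y) - (1 + \<i> * complex_of_real (s * y) - complex_of_real (s\<^sup>2 / 2 * y\<^sup>2)))
     \<le> s\<^sup>2 * min (y\<^sup>2) (\<bar>s\<bar> * \<bar>y\<bar> ^ 3)" (is "?R \<le> _")
proof -
  have *: "(\<Sum>k\<le>2. (\<i> * complex_of_real (s * y)) ^ k / fact k) =
      1 + \<i> * complex_of_real (s * y) - complex_of_real (s\<^sup>2 / 2 * y\<^sup>2)"
    by (simp add: numeral_2_eq_2 power2_eq_square algebra_simps)
  have "s\<^sup>2 * (\<bar>s\<bar> * \<bar>y\<bar> ^ 3) = \<bar>s\<bar>\<^sup>2 * (\<bar>s\<bar> * \<bar>y\<bar> ^ 3)" by simp
  also have "\<dots> = \<bar>s * y\<bar> ^ 3"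
    by (simp only: abs_mult power_mult_distrib power2_eq_square power3_eq_cube mult_ac)
  finally have cube: "s\<^sup>2 * (\<bar>s\<bar> * \<bar>y\<bar> ^ 3) = \<bar>s * y\<bar> ^ 3" .
  have "?R \<le> \<bar>s * y\<bar> ^ 3 / 6"
    using iexp_approx1[of "s * y" 2, unfolded *] by (simp only: eval_nat_numeral(3)[symmetric] fact_numeral) simp
  also have "\<dots> \<le> \<bar>s * y\<bar> ^ 3" by simp
  finally have cubic: "?R \<le> s\<^sup>2 * (\<bar>s\<bar> * \<bar>y\<bar> ^ 3)" unfolding cube .
  have quadratic: "?R \<le> s\<^sup>2 * y\<^sup>2"
    using iexp_approx2[of "s * y" 2, unfolded *] by (simp only: fact_2 power2_abs power_mult_distrib)
  have "R \<le> c * min a b" if "R \<le> c * a" "R \<le> c * b" for R a b c :: real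
    using that by (simp add: min_def)
  from this[OF quadratic cubic] show ?thesis .
qed

lemma cmod_iexp_diff_1_le: "cmod (iexp a - 1) \<le> 2"
  using norm_triangle_ineq4[of "iexp a" 1] by simp

lemma
  fixes f g :: "'a \<Rightarrow> real"
  assumes [measurable]: "f \<in> borel_measurable M" "g \<in> borel_measurable M"
    and int: "integrable M (\<lambda>x. (f x)\<^sup>2)" "integrable M (\<lambda>x. (g x)\<^sup>2)"
  shows square_integrable_mult: "integrable M (\<lambda>x. f x * g x)"
    and square_integrable_add: "integrable M (\<lambda>x. (f x + g x)\<^sup>2)"
    and square_integrable_diff: "integrable M (\<lambda>x. (f x - g x)\<^sup>2)"
proof -
  have "\<bar>f x * g x\<bar> \<le> (f x)\<^sup>2 + (g x)\<^sup>2" for x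
    using zero_le_power2[of "\<bar>f x\<bar> - \<bar>g x\<bar>"] zero_le_power2[of "f x"] zero_le_power2[of "g x"]
    unfolding power2_diff power2_abs abs_mult by linarith
  then show mult: "integrable M (\<lambda>x. f x * g x)"
    using int by (intro Bochner_Integration.integrable_bound[OF Bochner_Integration.integrable_add[OF int]]) auto
  have "integrable M (\<lambda>x. 2 * (f x * g x))" using mult by simp
  then show "integrable M (\<lambda>x. (f x + g x)\<^sup>2)" "integrable M (\<lambda>x. (f x - g x)\<^sup>2)"
    using int by (simp_all add: power2_sum power2_diff mult.assoc)
qed

text \<open>Cauchy-Schwarz against the weights r^n. L2 estimates control only the weighted squares;
  this turns them into pointwise convergence of the series and a bound for the square of its
  sum.\<close>

lemma weighted_Cauchy_Schwarz_suminf: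
  fixes a :: "nat \<Rightarrow> real"
  assumes r: "0 < r" "r < 1" and sm: "summable (\<lambda>n. (a n)\<^sup>2 / r ^ n)"
  shows "summable a" and "(\<Sum>n. a n)\<^sup>2 \<le> 1 / (1 - r) * (\<Sum>n. (a n)\<^sup>2 / r ^ n)"
proof -
  have geo: "summable (\<lambda>n. r ^ n)" using r by (intro summable_geometric) auto
  have "\<bar>a n\<bar> \<le> r ^ n + (a n)\<^sup>2 / r ^ n" for n
  proof -
    have "\<bar>a n\<bar> * r ^ n \<le> (r ^ n)\<^sup>2 + (a n)\<^sup>2"
      using zero_le_power2[of "\<bar>a n\<bar> - r ^ n"] zero_le_power2[of "a n"] zero_le_power2[of "r ^ n"]
      unfolding power2_diff power2_abs by linarith
    then show ?thesis using r by (simp add: field_simps power2_eq_square)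
  qed
  then show sa: "summable a"
    by (intro summable_comparison_test[OF _ summable_add[OF geo sm]]) auto
  have "(\<Sum>n<N. a n)\<^sup>2 \<le> 1 / (1 - r) * (\<Sum>n. (a n)\<^sup>2 / r ^ n)" for N
  proof -
    have "(\<Sum>n<N. a n)\<^sup>2 = (\<Sum>n<N. sqrt (r ^ n) * (a n / sqrt (r ^ n)))\<^sup>2"
      using r by simp
    also have "\<dots> \<le> (\<Sum>n<N. (sqrt (r ^ n))\<^sup>2) * (\<Sum>n<N. (a n / sqrt (r ^ n))\<^sup>2)"
      by (rule Cauchy_Schwarz_ineq_sum)
    also have "\<dots> = (\<Sum>n<N. r ^ n) * (\<Sum>n<N. (a n)\<^sup>2 / r ^ n)"
      using r by (simp add: power_divide)
    also have "\<dots> \<le> (\<Sum>n. r ^ n) * (\<Sum>n. (a n)\<^sup>2 / r ^ n)"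
      using r by (intro mult_mono sum_le_suminf geo sm suminf_nonneg sum_nonneg) auto
    finally show ?thesis using r by (simp add: suminf_geometric)
  qed
  then show "(\<Sum>n. a n)\<^sup>2 \<le> 1 / (1 - r) * (\<Sum>n. (a n)\<^sup>2 / r ^ n)"
    by (intro LIMSEQ_le_const2[OF tendsto_power[OF summable_LIMSEQ[OF sa]]]) auto
qed

section \<open>Central limit theorem for two-branch systems\<close>

text \<open>The \<open>scaleR\<close> form lets the same operator act on real functions and on
  complex phases.\<close>

definition half_sum :: "(bool \<Rightarrow> 'a \<Rightarrow> 'a) \<Rightarrow> ('a \<Rightarrow> 'b::real_vector) \<Rightarrow> 'a \<Rightarrow> 'b" where
  "half_sum Y g x = (1/2) *\<^sub>R (g (Y True x) + g (Y False x))"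

lemma half_sum_mult_left: "half_sum Y (\<lambda>x. c * g x) x = c * half_sum Y g x"
  for c :: "'b::real_algebra"
  by (simp add: half_sum_def distrib_left)

lemma half_sum_mono:
  fixes f g :: "'a \<Rightarrow> real"
  assumes "\<And>x. f x \<le> g x"
  shows "half_sum Y f x \<le> half_sum Y g x"
  unfolding half_sum_def by (intro scaleR_left_mono add_mono assms) simp

text \<open>\<open>distr_branches\<close> says that \<open>half_sum Y\<close> is the transfer operator of \<open>T\<close>: a fair coin choosing
  the inverse branch preserves \<open>M\<close>.\<close>

locale two_branch_system = prob_space M for M :: "'a measure" +
  fixes T :: "'a \<Rightarrow> 'a" and Y :: "bool \<Rightarrow> 'a \<Rightarrow> 'a"
  assumes T_measurable [measurable]: "T \<in> measurable M M"
    and Y_measurable [measurable]: "\<And>b. Y b \<in> measurable M M"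
    and T_Y: "\<And>b x. x \<in> space M \<Longrightarrow> T (Y b x) = x"
    and distr_branches:
      "distr (measure_pmf (bernoulli_pmf (1/2)) \<Otimes>\<^sub>M M) M (\<lambda>(b, x). Y b x) = M"
begin

abbreviation transfer :: "('a \<Rightarrow> 'b::real_vector) \<Rightarrow> 'a \<Rightarrow> 'b" where
  "transfer \<equiv> half_sum Y"

sublocale pair: pair_prob_space "measure_pmf (bernoulli_pmf (1/2))" M ..

section \<open>Invariance, duality and contraction for the transfer operator\<close>

lemma branches_measurable [measurable]:
  "(\<lambda>(b, x). Y b x) \<in> measurable (measure_pmf (bernoulli_pmf (1/2)) \<Otimes>\<^sub>M M) M"
proof -
  have "(\<lambda>(b, x). Y b x) \<in> measurable (count_space UNIV \<Otimes>\<^sub>M M) M"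
    by (intro measurable_pair_measure_countable1) auto
  moreover have "sets (measure_pmf (bernoulli_pmf (1/2)) \<Otimes>\<^sub>M M) = sets (count_space UNIV \<Otimes>\<^sub>M M)"
    by (intro sets_pair_measure_cong) auto
  ultimately show ?thesis
    using measurable_cong_sets[of "measure_pmf (bernoulli_pmf (1/2)) \<Otimes>\<^sub>M M" _ M M] by blast
qed

text \<open>By \<open>distr_branches\<close>, Fubini over coin and point gives integrability for
  almost every outcome b, hence for both, as each has probability 1/2.\<close>

lemma integrable_branch:
  fixes g :: "'a \<Rightarrow> 'b::{banach, second_countable_topology}"
  assumes "integrable M g"
  shows "integrable M (\<lambda>x. g (Y b x))"
    and "(\<integral>x. g x \<partial>M) = (1/2) *\<^sub>R ((\<integral>x. g (Y True x) \<partial>M) + (\<integral>x. g (Y False x) \<partial>M))"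
proof -
  let ?B = "measure_pmf (bernoulli_pmf (1/2))"
  have int: "integrable (?B \<Otimes>\<^sub>M M) (\<lambda>(b, x). g (Y b x))"
    using integrable_distr[OF branches_measurable, of g] assms
    by (simp only: distr_branches) (simp add: case_prod_unfold)
  have "AE b in ?B. integrable M (\<lambda>x. g (Y b x))"
    using pair.AE_integrable_fst'[OF int] by simp
  then show "integrable M (\<lambda>x. g (Y b x))"
    by (auto simp: AE_measure_pmf_iff)
  have gm: "g \<in> borel_measurable M" using assms by auto
  have "(\<integral>x. g x \<partial>M) = (\<integral>z. g (case z of (b, x) \<Rightarrow> Y b x) \<partial>(?B \<Otimes>\<^sub>M M))"
    using integral_distr[OF branches_measurable gm] by (simp add: distr_branches)
  also have "\<dots> = (\<integral>b. (\<integral>x. g (Y b x) \<partial>M) \<partial>?B)"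
    using pair.integral_fst'[OF int] by (simp add: case_prod_unfold)
  also have "\<dots> = (1/2) *\<^sub>R ((\<integral>x. g (Y True x) \<partial>M) + (\<integral>x. g (Y False x) \<partial>M))"
    by (simp add: integral_measure_pmf[of UNIV] UNIV_bool scaleR_add_right)
  finally show "(\<integral>x. g x \<partial>M) = (1/2) *\<^sub>R ((\<integral>x. g (Y True x) \<partial>M) + (\<integral>x. g (Y False x) \<partial>M))" .
qed

lemma transfer_measurable [measurable (raw)]:
  fixes g :: "'a \<Rightarrow> 'b::{banach, second_countable_topology}"
  assumes [measurable]: "g \<in> borel_measurable M"
  shows "transfer g \<in> borel_measurable M"
  unfolding half_sum_def by measurable

lemma integrable_transfer:
  fixes g :: "'a \<Rightarrow> 'b::{banach, second_countable_topology}"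
  assumes "integrable M g"
  shows "integrable M (transfer g)"
  unfolding half_sum_def[abs_def]
  by (intro integrable_scaleR_right Bochner_Integration.integrable_add integrable_branch assms)

lemma integral_transfer:
  fixes g :: "'a \<Rightarrow> 'b::{banach, second_countable_topology}"
  assumes "integrable M g"
  shows "(\<integral>x. transfer g x \<partial>M) = (\<integral>x. g x \<partial>M)"
  unfolding half_sum_def using integrable_branch[OF assms] by simp

lemma AE_branch:
  assumes "AE x in M. P x"
  shows "AE x in M. P (Y b x)"
proof -
  let ?B = "measure_pmf (bernoulli_pmf (1/2))"
  have "AE z in ?B \<Otimes>\<^sub>M M. P (case z of (b, x) \<Rightarrow> Y b x)"
    by (rule AE_distrD[OF branches_measurable]) (simp only: distr_branches assms)
  then have "AE b in ?B. AE x in M. P (Y b x)"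
    using pair.AE_pair by fastforce
  then show ?thesis by (auto simp: AE_measure_pmf_iff)
qed

text \<open>Once M is written as the image of coin times M, \<open>T_Y\<close> turns the
  push-forward by T into the projection that forgets the coin.\<close>

lemma distr_T: "distr M M T = M"
proof -
  let ?B = "measure_pmf (bernoulli_pmf (1/2))"
  have "distr M M T = distr (distr (?B \<Otimes>\<^sub>M M) M (\<lambda>(b, x). Y b x)) M T"
    by (simp add: distr_branches)
  also have "\<dots> = distr (?B \<Otimes>\<^sub>M M) M snd"
    by (subst distr_distr) (auto intro!: distr_cong simp: T_Y space_pair_measure)
  also have "\<dots> = M"
  proof (rule measure_eqI)
    fix A assume "A \<in> sets (distr (?B \<Otimes>\<^sub>M M) M snd)"
    then have [measurable]: "A \<in> sets M" by simp
    have "emeasure (distr (?B \<Otimes>\<^sub>M M) M snd) A = emeasure (?B \<Otimes>\<^sub>M M) (UNIV \<times> A)"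
      using sets.sets_into_space[of A M]
      by (subst emeasure_distr) (auto intro!: arg_cong[where f="emeasure _"] simp: space_pair_measure)
    then show "emeasure (distr (?B \<Otimes>\<^sub>M M) M snd) A = emeasure M A"
      by (simp add: emeasure_pair_measure_Times measure_pmf.emeasure_eq_measure measure_pmf_UNIV)
  qed simp
  finally show ?thesis .
qed

lemma T_iterate_measurable [measurable]: "T ^^ n \<in> measurable M M"
  by (induction n) auto

lemma distr_T_iterate: "distr M M (T ^^ n) = M"
proof (induction n)
  case 0 show ?case using distr_id2[of M M] by (simp add: id_def)
next
  case (Suc n)
  have "distr M M (T ^^ Suc n) = distr (distr M M (T ^^ n)) M T"
    by (subst distr_distr) auto
  then show ?case by (simp only: Suc distr_T)
qed

lemma
  fixes g :: "'a \<Rightarrow> 'b::{banach, second_countable_topology}"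
  assumes "g \<in> borel_measurable M"
  shows integral_T_iterate: "(\<integral>x. g ((T ^^ n) x) \<partial>M) = (\<integral>x. g x \<partial>M)"
    and integrable_T_iterate: "integrable M (\<lambda>x. g ((T ^^ n) x)) \<longleftrightarrow> integrable M g"
  using integral_distr[of "T ^^ n" M M g] integrable_distr_eq[of "T ^^ n" M M g] assms
  by (simp_all add: distr_T_iterate)

text \<open>U o T takes the same value U x at both preimages of x and so leaves the average: the
  pointwise form of the duality between \<open>half_sum\<close> and composition with T.\<close>

lemma transfer_mult_T:
  fixes g U :: "'a \<Rightarrow> 'b::real_normed_algebra"
  shows "x \<in> space M \<Longrightarrow> transfer (\<lambda>x. g x * U (T x)) x = transfer g x * U x"
  by (simp add: half_sum_def T_Y distrib_right)

lemma integral_mult_T: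
  fixes g U :: "'a \<Rightarrow> 'b::{real_normed_algebra, banach, second_countable_topology}"
  assumes "integrable M (\<lambda>x. g x * U (T x))"
  shows "integrable M (\<lambda>x. transfer g x * U x)"
    and "(\<integral>x. g x * U (T x) \<partial>M) = (\<integral>x. transfer g x * U x \<partial>M)"
  using integrable_transfer[OF assms] integral_transfer[OF assms]
  by (simp_all add: transfer_mult_T cong: Bochner_Integration.integrable_cong Bochner_Integration.integral_cong)

lemma transfer_iterate_measurable [measurable (raw)]:
  fixes g :: "'a \<Rightarrow> real"
  shows "g \<in> borel_measurable M \<Longrightarrow> (transfer ^^ n) g \<in> borel_measurable M"
  by (induction n) (auto intro: transfer_measurable)

lemma integrable_transfer_iterate:
  fixes g :: "'a \<Rightarrow> real"
  shows "integrable M g \<Longrightarrow> integrable M ((transfer ^^ n) g)"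
  by (induction n) (auto intro: integrable_transfer)

lemma integral_transfer_iterate:
  fixes g :: "'a \<Rightarrow> real"
  shows "integrable M g \<Longrightarrow> (\<integral>x. (transfer ^^ n) g x \<partial>M) = (\<integral>x. g x \<partial>M)"
  by (induction n) (auto simp: integral_transfer integrable_transfer_iterate)

lemma half_sum_of_real:
  "half_sum Y (\<lambda>x. of_real (w x) :: 'c::real_normed_algebra_1) = (\<lambda>x. of_real (half_sum Y w x))"
  by (simp add: half_sum_def fun_eq_iff of_real_def scaleR_add_left scaleR_add_right add_divide_distrib)

text \<open>A bounded U keeps the product integrable although w is merely in L1, so the one-step
  duality can be repeated n times.\<close>

lemma integral_mult_T_iterate:
  fixes w :: "'a \<Rightarrow> real" and U :: "'a \<Rightarrow> complex"
  assumes w: "integrable M w" and U [measurable]: "U \<in> borel_measurable M"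
    and bnd: "\<And>x. cmod (U x) \<le> 1"
  shows "(\<integral>x. of_real (w x) * U ((T ^^ n) x) \<partial>M) = (\<integral>x. of_real ((transfer ^^ n) w x) * U x \<partial>M)"
  using w
proof (induction n arbitrary: w)
  case 0 then show ?case by simp
next
  case (Suc n)
  have [measurable]: "w \<in> borel_measurable M" using Suc.prems by auto
  have "integrable M (\<lambda>x. complex_of_real (w x) * U ((T ^^ n) (T x)))"
    by (rule Bochner_Integration.integrable_bound[OF Suc.prems])
      (auto simp: norm_mult intro!: mult_left_le bnd)
  from integral_mult_T(2)[OF this]
  have "(\<integral>x. of_real (w x) * U ((T ^^ Suc n) x) \<partial>M) = (\<integral>x. of_real (transfer w x) * U ((T ^^ n) x) \<partial>M)"
    by (simp add: half_sum_of_real funpow_swap1)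
  also have "\<dots> = (\<integral>x. of_real ((transfer ^^ n) (transfer w) x) * U x \<partial>M)"
    by (intro Suc.IH integrable_transfer Suc.prems)
  finally show ?case by (simp add: funpow_swap1)
qed

lemma norm_half_sum_le:
  fixes g :: "'a \<Rightarrow> 'b::real_normed_vector"
  shows "norm (half_sum Y g x) \<le> half_sum Y (\<lambda>x. norm (g x)) x"
  unfolding half_sum_def by (simp add: norm_triangle_ineq)

text \<open>Jensen for a two-point average: the gap is the square of half the difference of the two
  values.\<close>

lemma square_half_sum_le:
  fixes g :: "'a \<Rightarrow> real"
  shows "(half_sum Y g x)\<^sup>2 \<le> half_sum Y (\<lambda>x. (g x)\<^sup>2) x"
  unfolding half_sum_def using zero_le_power2[of "g (Y True x) - g (Y False x)"]
  by (simp add: power2_eq_square algebra_simps)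

lemma transfer_L1_contract:
  fixes g :: "'a \<Rightarrow> real"
  assumes "integrable M g"
  shows "(\<integral>x. \<bar>(transfer ^^ n) g x\<bar> \<partial>M) \<le> (\<integral>x. \<bar>g x\<bar> \<partial>M)"
proof (induction n)
  case (Suc n)
  let ?g = "(transfer ^^ n) g"
  have i: "integrable M ?g" by (rule integrable_transfer_iterate[OF assms])
  have "(\<integral>x. \<bar>transfer ?g x\<bar> \<partial>M) \<le> (\<integral>x. transfer (\<lambda>x. \<bar>?g x\<bar>) x \<partial>M)"
    using i norm_half_sum_le[of ?g] by (intro integral_mono integrable_abs integrable_transfer) auto
  also have "\<dots> = (\<integral>x. \<bar>?g x\<bar> \<partial>M)" using i by (intro integral_transfer integrable_abs)
  finally show ?case using Suc by simp
qed simp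

lemma transfer_L2_contract:
  fixes g :: "'a \<Rightarrow> real"
  assumes [measurable]: "g \<in> borel_measurable M" and "integrable M (\<lambda>x. (g x)\<^sup>2)"
  shows "integrable M (\<lambda>x. ((transfer ^^ n) g x)\<^sup>2) \<and>
    (\<integral>x. ((transfer ^^ n) g x)\<^sup>2 \<partial>M) \<le> (\<integral>x. (g x)\<^sup>2 \<partial>M)"
proof (induction n)
  case (Suc n)
  let ?g = "(transfer ^^ n) g"
  have i: "integrable M (\<lambda>x. (?g x)\<^sup>2)" using Suc by simp
  have i2: "integrable M (\<lambda>x. (transfer ?g x)\<^sup>2)"
    by (rule Bochner_Integration.integrable_bound[OF integrable_transfer[OF i]])
      (auto intro!: order_trans[OF square_half_sum_le])
  have "(\<integral>x. (transfer ?g x)\<^sup>2 \<partial>M) \<le> (\<integral>x. transfer (\<lambda>x. (?g x)\<^sup>2) x \<partial>M)"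
    using i i2 square_half_sum_le[of ?g] by (intro integral_mono integrable_transfer) auto
  also have "\<dots> = (\<integral>x. (?g x)\<^sup>2 \<partial>M)" using i by (intro integral_transfer)
  finally show ?case using Suc i2 by simp
qed (use assms in simp)

section \<open>Birkhoff sums and the recursion for their characteristic functions\<close>

definition ergodic_sum :: "('a \<Rightarrow> real) \<Rightarrow> nat \<Rightarrow> 'a \<Rightarrow> real" where
  "ergodic_sum m n x = (\<Sum>k<n. m ((T ^^ k) x))"

lemma ergodic_sum_add: "ergodic_sum m (p + n) x = ergodic_sum m p x + ergodic_sum m n ((T ^^ p) x)"
proof -
  have "(\<Sum>k<p+n. m ((T ^^ k) x)) = (\<Sum>k<p. m ((T ^^ k) x)) + (\<Sum>k=p..<p+n. m ((T ^^ k) x))"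
    by (metis atLeast0LessThan le_add1 sum.atLeastLessThan_concat zero_le)
  also have "(\<Sum>k=p..<p+n. m ((T ^^ k) x)) = (\<Sum>k<n. m ((T ^^ k) ((T ^^ p) x)))"
    using sum.shift_bounds_nat_ivl[of "\<lambda>k. m ((T ^^ k) x)" 0 p n]
    by (simp add: funpow_add lessThan_atLeast0 add.commute)
  finally show ?thesis by (simp add: ergodic_sum_def)
qed

lemma ergodic_sum_Suc: "ergodic_sum m (Suc n) x = m x + ergodic_sum m n (T x)"
  using ergodic_sum_add[of m 1 n x] by (simp add: ergodic_sum_def)

lemma ergodic_sum_measurable [measurable (raw)]:
  assumes [measurable]: "m \<in> borel_measurable M" "f \<in> measurable N M"
  shows "(\<lambda>x. ergodic_sum m n (f x)) \<in> borel_measurable N"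
  unfolding ergodic_sum_def by measurable

lemma integrable_mult_iexp:
  fixes g :: "'a \<Rightarrow> complex"
  assumes "integrable M g" and [measurable]: "S \<in> borel_measurable M"
  shows "integrable M (\<lambda>x. g x * iexp (s * S x))"
proof -
  have [measurable]: "g \<in> borel_measurable M" using assms by auto
  show ?thesis
    by (rule Bochner_Integration.integrable_bound[OF assms(1)]) (auto simp: norm_mult)
qed

lemma integrable_iexp_scale:
  assumes [measurable]: "S \<in> borel_measurable M"
  shows "integrable M (\<lambda>x. iexp (s * S x))"
  using integrable_mult_iexp[of "\<lambda>_. 1" S s] by simp

text \<open>The phase of the sum factors as V * (U o T^p), with V from the first p terms. Replacing
  V by 1 costs the first integral, which is small for fixed p and small s; after that w meets only a
  function of T^p x, so duality replaces w by its p-th transfer and mixing takes over.\<close>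

lemma mixing_bound:
  assumes w: "integrable M w" and [measurable]: "m \<in> borel_measurable M"
  shows "cmod (\<integral>x. of_real (w x) * iexp (s * ergodic_sum m (p + n) x) \<partial>M)
    \<le> (\<integral>x. \<bar>w x\<bar> * cmod (iexp (s * ergodic_sum m p x) - 1) \<partial>M) + (\<integral>x. \<bar>(transfer ^^ p) w x\<bar> \<partial>M)"
proof -
  have [measurable]: "w \<in> borel_measurable M" using w by auto
  let ?U = "\<lambda>x. iexp (s * ergodic_sum m n x)"
  let ?V = "\<lambda>x. iexp (s * ergodic_sum m p x)"
  have i1: "integrable M (\<lambda>x. of_real (w x) * (?V x - 1) * ?U ((T ^^ p) x))"
    by (rule Bochner_Integration.integrable_bound[OF integrable_mult_right[OF w, of 2]])
      (auto simp: norm_mult mult.commute[of 2] abs_mult cmod_iexp_diff_1_le simp del: of_real_mult intro!: mult_left_mono)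
  have i2: "integrable M (\<lambda>x. of_real (w x) * ?U ((T ^^ p) x))"
    by (rule Bochner_Integration.integrable_bound[OF w]) (auto simp: norm_mult)
  have "(\<integral>x. of_real (w x) * iexp (s * ergodic_sum m (p + n) x) \<partial>M)
     = (\<integral>x. of_real (w x) * (?V x - 1) * ?U ((T ^^ p) x) + of_real (w x) * ?U ((T ^^ p) x) \<partial>M)"
    by (simp only: ergodic_sum_add) (simp add: distrib_left exp_add algebra_simps)
  also have "\<dots> = (\<integral>x. of_real (w x) * (?V x - 1) * ?U ((T ^^ p) x) \<partial>M)
      + (\<integral>x. of_real ((transfer ^^ p) w x) * ?U x \<partial>M)"
    using integral_mult_T_iterate[OF w, of ?U p] i1 i2 by simp
  finally have "cmod (\<integral>x. of_real (w x) * iexp (s * ergodic_sum m (p + n) x) \<partial>M) \<le>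
     cmod (\<integral>x. of_real (w x) * (?V x - 1) * ?U ((T ^^ p) x) \<partial>M)
      + cmod (\<integral>x. of_real ((transfer ^^ p) w x) * ?U x \<partial>M)"
    by (simp only: norm_triangle_ineq)
  also have "\<dots> \<le> (\<integral>x. cmod (of_real (w x) * (?V x - 1) * ?U ((T ^^ p) x)) \<partial>M)
      + (\<integral>x. cmod (of_real ((transfer ^^ p) w x) * ?U x) \<partial>M)"
    by (intro add_mono integral_norm_bound)
  finally show ?thesis by (simp add: norm_mult)
qed

text \<open>By duality only the transfer of exp(i s m) meets the phase of the remaining n terms. In
  its Taylor expansion the linear term dies because \<open>transfer m\<close> vanishes, and the
  quadratic term is split into the constant v, which gives the multiplier, and the fluctuation
  around it.\<close>

lemma char_step:
  assumes [measurable]: "m \<in> borel_measurable M" and m2: "integrable M (\<lambda>x. (m x)\<^sup>2)"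
    and Lm: "AE x in M. transfer m x = 0"
  shows "cmod ((\<integral>x. iexp (s * ergodic_sum m (Suc n) x) \<partial>M)
        - of_real (1 - s\<^sup>2 / 2 * v) * (\<integral>x. iexp (s * ergodic_sum m n x) \<partial>M))
    \<le> s\<^sup>2 * (\<integral>x. min ((m x)\<^sup>2) (\<bar>s\<bar> * \<bar>m x\<bar> ^ 3) \<partial>M) + s\<^sup>2 / 2 *
       cmod (\<integral>x. of_real (transfer (\<lambda>x. (m x)\<^sup>2) x - v) * iexp (s * ergodic_sum m n x) \<partial>M)"
proof -
  let ?U = "\<lambda>x. iexp (s * ergodic_sum m n x)"
  let ?G = "\<lambda>x. iexp (s * m x)"
  let ?w = "\<lambda>x. transfer (\<lambda>x. (m x)\<^sup>2) x - v"
  let ?e = "\<lambda>x. min ((m x)\<^sup>2) (\<bar>s\<bar> * \<bar>m x\<bar> ^ 3)"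
  \<comment> \<open>The \<open>?w\<close> term is added back so that v cancels and r is the transfer
    of the second-order Taylor remainder wherever \<open>transfer m\<close> vanishes.\<close>
  define r where "r x = transfer ?G x - of_real (1 - s\<^sup>2 / 2 * v) + of_real (s\<^sup>2 / 2 * ?w x)" for x
  have e: "integrable M ?e"
    by (rule Bochner_Integration.integrable_bound[OF m2]) auto
  have G: "integrable M ?G" by (rule integrable_iexp_scale) simp
  have w: "integrable M ?w" by (intro Bochner_Integration.integrable_diff integrable_transfer m2) simp
  have r: "integrable M r" unfolding r_def
    using w by (intro Bochner_Integration.integrable_add Bochner_Integration.integrable_diff integrable_transfer G integrable_of_real) auto
  have eq: "r x = transfer (\<lambda>x. ?G x - (1 + \<i> * complex_of_real (s * m x) - complex_of_real (s\<^sup>2 / 2 * (m x)\<^sup>2))) x"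
    if "transfer m x = 0" for x
  proof -
    have "m (Y True x) = - m (Y False x)" using that by (simp add: half_sum_def)
    then show ?thesis by (simp add: r_def half_sum_def scaleR_conv_of_real algebra_simps)
  qed
  have rb: "cmod (r x) \<le> s\<^sup>2 * transfer ?e x" if "transfer m x = 0" for x
    unfolding eq[OF that] half_sum_mult_left[symmetric]
    by (intro order_trans[OF norm_half_sum_le] half_sum_mono iexp_quadratic_remainder)
  have rU: "AE x in M. cmod (r x * ?U x) \<le> s\<^sup>2 * transfer ?e x"
    using Lm by eventually_elim (simp only: norm_mult norm_exp_i_times mult_1_right rb)
  have iA: "integrable M (\<lambda>x. r x * ?U x)"
    by (intro integrable_mult_iexp r) simp
  have iB: "integrable M (\<lambda>x. of_real (1 - s\<^sup>2 / 2 * v) * ?U x)"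
    by (intro integrable_mult_right integrable_iexp_scale) simp
  have iC: "integrable M (\<lambda>x. of_real (s\<^sup>2 / 2) * (of_real (?w x) * ?U x))"
    by (intro integrable_mult_right integrable_mult_iexp integrable_of_real w) simp
  have "(\<integral>x. iexp (s * ergodic_sum m (Suc n) x) \<partial>M) = (\<integral>x. ?G x * ?U (T x) \<partial>M)"
    by (simp add: ergodic_sum_Suc distrib_left exp_add)
  also have "\<dots> = (\<integral>x. transfer ?G x * ?U x \<partial>M)"
    using integrable_mult_iexp[OF G, of "\<lambda>x. ergodic_sum m n (T x)" s] by (intro integral_mult_T) simp
  also have "\<dots> = (\<integral>x. r x * ?U x + of_real (1 - s\<^sup>2 / 2 * v) * ?U x - of_real (s\<^sup>2 / 2) * (of_real (?w x) * ?U x) \<partial>M)"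
    by (intro Bochner_Integration.integral_cong) (simp_all add: r_def algebra_simps)
  also have "\<dots> = (\<integral>x. r x * ?U x \<partial>M) + of_real (1 - s\<^sup>2 / 2 * v) * (\<integral>x. ?U x \<partial>M)
       - of_real (s\<^sup>2 / 2) * (\<integral>x. of_real (?w x) * ?U x \<partial>M)"
    by (subst Bochner_Integration.integral_diff[OF Bochner_Integration.integrable_add[OF iA iB] iC])
      (subst Bochner_Integration.integral_add[OF iA iB], simp only: integral_mult_right_zero)
  finally have split: "(\<integral>x. iexp (s * ergodic_sum m (Suc n) x) \<partial>M) = (\<integral>x. r x * ?U x \<partial>M)
      + of_real (1 - s\<^sup>2 / 2 * v) * (\<integral>x. ?U x \<partial>M) - of_real (s\<^sup>2 / 2) * (\<integral>x. of_real (?w x) * ?U x \<partial>M)" .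
  have cancel: "a + b - c - b = a - c" for a b c :: complex by simp
  have "cmod ((\<integral>x. iexp (s * ergodic_sum m (Suc n) x) \<partial>M)
        - of_real (1 - s\<^sup>2 / 2 * v) * (\<integral>x. ?U x \<partial>M)) =
     cmod ((\<integral>x. r x * ?U x \<partial>M) - of_real (s\<^sup>2 / 2) * (\<integral>x. of_real (?w x) * ?U x \<partial>M))"
    by (simp only: split cancel)
  also have "\<dots> \<le> cmod (\<integral>x. r x * ?U x \<partial>M) + s\<^sup>2 / 2 * cmod (\<integral>x. of_real (?w x) * ?U x \<partial>M)"
    by (rule order_trans[OF norm_triangle_ineq4]) (simp only: norm_mult norm_of_real, simp)
  also have "cmod (\<integral>x. r x * ?U x \<partial>M) \<le> (\<integral>x. s\<^sup>2 * transfer ?e x \<partial>M)"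
    using integrable_mult_iexp[OF r, of "ergodic_sum m n" s] rU e
    by (intro order_trans[OF integral_norm_bound] integral_mono_AE integrable_mult_right integrable_transfer integrable_norm)
      auto
  also have "\<dots> = s\<^sup>2 * (\<integral>x. ?e x \<partial>M)" using integral_transfer[OF e] by simp
  finally show ?thesis by simp
qed

lemma martingale_char_limit:
  assumes [measurable]: "m \<in> borel_measurable M" and m2: "integrable M (\<lambda>x. (m x)\<^sup>2)"
    and Lm: "AE x in M. transfer m x = 0"
    and exact: "\<And>w :: 'a \<Rightarrow> real. integrable M w \<Longrightarrow> (\<integral>x. w x \<partial>M) = 0 \<Longrightarrow>
      (\<lambda>p. \<integral>x. \<bar>(transfer ^^ p) w x\<bar> \<partial>M) \<longlonglongrightarrow> 0"
  defines "v \<equiv> \<integral>x. (m x)\<^sup>2 \<partial>M"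
  shows "(\<lambda>n. \<integral>x. iexp (t / sqrt n * ergodic_sum m n x) \<partial>M) \<longlonglongrightarrow> of_real (exp (- (t\<^sup>2 * v / 2)))"
proof -
  define w where "w x = transfer (\<lambda>x. (m x)\<^sup>2) x - v" for x
  have w: "integrable M w" unfolding w_def
    by (intro Bochner_Integration.integrable_diff integrable_transfer m2) simp
  then have [measurable]: "w \<in> borel_measurable M" by auto
  have w0: "(\<integral>x. w x \<partial>M) = 0"
    unfolding w_def using integrable_transfer[OF m2] integral_transfer[OF m2]
    by (simp add: v_def prob_space)
  define W where "W = (\<integral>x. \<bar>w x\<bar> \<partial>M)"
  define e where "e s = (\<integral>x. min ((m x)\<^sup>2) (\<bar>s\<bar> * \<bar>m x\<bar> ^ 3) \<partial>M)" for s :: real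
  define D where "D p s = (\<integral>x. \<bar>w x\<bar> * cmod (iexp (s * ergodic_sum m p x) - 1) \<partial>M)" for p s
  define E where "E p = (\<integral>x. \<bar>(transfer ^^ p) w x\<bar> \<partial>M)" for p
  define \<phi> where "\<phi> s n = (\<integral>x. iexp (s * ergodic_sum m n x) \<partial>M)" for s n
  have [simp]: "D p s \<ge> 0" "E p \<ge> 0" "W \<ge> 0" "v \<ge> 0" for p s
    by (simp_all add: D_def E_def W_def v_def)
  have wb: "cmod (\<integral>x. of_real (w x) * iexp (s * ergodic_sum m j x) \<partial>M) \<le> (if j < p then W else D p s + E p)" for j p s
  proof (cases "j < p")
    case True
    have "cmod (\<integral>x. of_real (w x) * iexp (s * ergodic_sum m j x) \<partial>M) \<le>
       (\<integral>x. cmod (of_real (w x) * iexp (s * ergodic_sum m j x)) \<partial>M)" by (rule integral_norm_bound)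
    then show ?thesis using True by (simp add: norm_mult W_def)
  next
    case False
    then show ?thesis using mixing_bound[OF w, of m s p "j - p"] by (simp add: D_def E_def)
  qed
  have sum_bound: "(\<Sum>j<n. (if j < p then W else D p s + E p)) \<le> p * W + n * (D p s + E p)" for n p :: nat and s
  proof -
    have "(\<Sum>j<n. (if j < p then W else D p s + E p)) \<le> (\<Sum>j<n. (if j < p then W else 0) + (D p s + E p))"
      by (intro sum_mono) auto
    also have "\<dots> = card ({..<n} \<inter> {..<p}) * W + n * (D p s + E p)"
      by (simp add: sum.distrib sum.If_cases lessThan_def)
    also have "\<dots> \<le> p * W + n * (D p s + E p)"
      using card_mono[of "{..<p}" "{..<n} \<inter> {..<p}"] by (intro add_right_mono mult_right_mono) auto
    finally show ?thesis .
  qed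
  \<comment> \<open>The condition t^2 v / 4 <= n puts the multiplier 1 - s^2 v / 2 into [-1, 1], as
    telescoping requires.\<close>
  have key: "cmod (\<phi> (t / sqrt n) n - of_real (1 - (t / sqrt n)\<^sup>2 / 2 * v) ^ n) \<le>
       t\<^sup>2 * e (t / sqrt n) + t\<^sup>2 / 2 * (p * W / n + D p (t / sqrt n)) + t\<^sup>2 / 2 * E p"
    if n: "n > 0" "t\<^sup>2 * v / 4 \<le> real n" for n p
  proof -
    let ?s = "t / sqrt n"
    have s2: "?s\<^sup>2 = t\<^sup>2 / n" using n by (simp add: power_divide)
    have "t\<^sup>2 * v \<le> 4 * real n" using n by simp
    then have "0 \<le> ?s\<^sup>2 / 2 * v" "?s\<^sup>2 / 2 * v \<le> 2" using n by (simp_all add: s2 divide_le_eq)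
    then have q: "\<bar>1 - ?s\<^sup>2 / 2 * v\<bar> \<le> 1" by linarith
    have "cmod (\<phi> ?s n - of_real (1 - ?s\<^sup>2 / 2 * v) ^ n) \<le>
      (\<Sum>j<n. cmod (\<phi> ?s (Suc j) - of_real (1 - ?s\<^sup>2 / 2 * v) * \<phi> ?s j))"
      using q by (intro norm_telescope_geometric)
        (simp_all add: \<phi>_def ergodic_sum_def prob_space del: of_real_diff)
    also have "\<dots> \<le> (\<Sum>j<n. ?s\<^sup>2 * e ?s + ?s\<^sup>2 / 2 * (if j < p then W else D p ?s + E p))"
      unfolding \<phi>_def e_def
      by (intro sum_mono order_trans[OF char_step[OF _ m2 Lm]] add_mono order.refl mult_left_mono wb[unfolded w_def]) auto
    also have "\<dots> = n * ?s\<^sup>2 * e ?s + ?s\<^sup>2 / 2 * (\<Sum>j<n. (if j < p then W else D p ?s + E p))"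
      by (simp add: sum.distrib sum_distrib_left)
    also have "\<dots> \<le> n * ?s\<^sup>2 * e ?s + ?s\<^sup>2 / 2 * (p * W + n * (D p ?s + E p))"
      by (intro add_mono mult_left_mono sum_bound) auto
    also have "\<dots> = t\<^sup>2 * e ?s + t\<^sup>2 / 2 * (p * W / n + D p ?s) + t\<^sup>2 / 2 * E p"
      using n by (simp add: s2 field_simps)
    finally show ?thesis .
  qed
  have s0: "(\<lambda>n. t / sqrt (real n)) \<longlonglongrightarrow> 0" by real_asymp
  have e0: "(\<lambda>n. e (t / sqrt n)) \<longlonglongrightarrow> 0"
  proof -
    have "(\<lambda>n. min ((m x)\<^sup>2) (\<bar>t / sqrt (real n)\<bar> * \<bar>m x\<bar> ^ 3)) \<longlonglongrightarrow> min ((m x)\<^sup>2) (\<bar>0\<bar> * \<bar>m x\<bar> ^ 3)" for x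
      by (intro tendsto_intros s0)
    then have "(\<lambda>n. e (t / sqrt n)) \<longlonglongrightarrow> (\<integral>x. 0 \<partial>M)"
      unfolding e_def by (intro integral_dominated_convergence[where w = "\<lambda>x. (m x)\<^sup>2"] m2) auto
    then show ?thesis by simp
  qed
  have D0: "(\<lambda>n. D p (t / sqrt n)) \<longlonglongrightarrow> 0" for p
  proof -
    have "(\<lambda>n. \<bar>w x\<bar> * cmod (iexp (t / sqrt (real n) * ergodic_sum m p x) - 1)) \<longlonglongrightarrow>
        \<bar>w x\<bar> * cmod (iexp (0 * ergodic_sum m p x) - 1)" for x
      by (intro tendsto_intros s0)
    then have "(\<lambda>n. D p (t / sqrt n)) \<longlonglongrightarrow> (\<integral>x. 0 \<partial>M)"
      unfolding D_def using w
      by (intro integral_dominated_convergence[where w = "\<lambda>x. 2 * \<bar>w x\<bar>"])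
         (auto simp: mult.commute[of 2] abs_mult cmod_iexp_diff_1_le simp del: of_real_mult of_real_divide intro!: mult_left_mono)
    then show ?thesis by simp
  qed
  have diff0: "(\<lambda>n. \<phi> (t / sqrt n) n - of_real (1 - (t / sqrt n)\<^sup>2 / 2 * v) ^ n) \<longlonglongrightarrow> 0"
  proof (rule tendsto_norm_zero_cancel, rule order_tendstoI)
    fix a :: real assume "a < 0"
    then show "\<forall>\<^sub>F n in sequentially. a < cmod (\<phi> (t / sqrt n) n - of_real (1 - (t / sqrt n)\<^sup>2 / 2 * v) ^ n)"
      by (intro always_eventually allI less_le_trans[OF _ norm_ge_zero])
  next
    fix a :: real assume a: "0 < a"
    \<comment> \<open>p is fixed before n: the mixing error does not depend on n, and the remaining
      terms vanish as n grows with p held fixed.\<close>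
    have "(\<lambda>p. t\<^sup>2 / 2 * E p) \<longlonglongrightarrow> t\<^sup>2 / 2 * 0"
      unfolding E_def by (intro tendsto_intros exact w w0)
    then have "\<forall>\<^sub>F p in sequentially. t\<^sup>2 / 2 * E p < a / 2" by (rule order_tendstoD(2)) (use a in simp)
    then obtain p where p: "t\<^sup>2 / 2 * E p < a / 2" by (auto simp: eventually_sequentially)
    have "(\<lambda>n. t\<^sup>2 * e (t / sqrt n) + t\<^sup>2 / 2 * (p * W / n + D p (t / sqrt n))) \<longlonglongrightarrow> t\<^sup>2 * 0 + t\<^sup>2 / 2 * (0 + 0)"
      by (intro tendsto_intros e0 D0)
    then have "\<forall>\<^sub>F n in sequentially. t\<^sup>2 * e (t / sqrt n) + t\<^sup>2 / 2 * (p * W / n + D p (t / sqrt n)) < a / 2"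
      by (rule order_tendstoD(2)) (use a in simp)
    moreover have "\<forall>\<^sub>F n in sequentially. n > 0 \<and> t\<^sup>2 * v / 4 \<le> real n"
      using eventually_gt_at_top[of 0] by (intro eventually_conj filterlim_real_sequentially[THEN filterlim_at_top[THEN iffD1], rule_format]) auto
    ultimately show "\<forall>\<^sub>F n in sequentially. cmod (\<phi> (t / sqrt n) n - of_real (1 - (t / sqrt n)\<^sup>2 / 2 * v) ^ n) < a"
    proof eventually_elim
      case (elim n)
      then show ?case using key[of n p] p by linarith
    qed
  qed
  have "(\<lambda>n. complex_of_real ((1 + (- (t\<^sup>2 * v / 2)) / n) ^ n)) \<longlonglongrightarrow> of_real (exp (- (t\<^sup>2 * v / 2)))"
    by (intro tendsto_of_real tendsto_exp_limit_sequentially)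
  moreover have "\<forall>\<^sub>F n in sequentially. complex_of_real ((1 + (- (t\<^sup>2 * v / 2)) / n) ^ n) =
      of_real (1 - (t / sqrt n)\<^sup>2 / 2 * v) ^ n"
    using eventually_gt_at_top[of 0] by eventually_elim (simp add: power_divide mult.commute)
  ultimately have "(\<lambda>n. complex_of_real (1 - (t / sqrt n)\<^sup>2 / 2 * v) ^ n) \<longlonglongrightarrow> of_real (exp (- (t\<^sup>2 * v / 2)))"
    by (rule Lim_transform_eventually)
  from tendsto_add[OF diff0 this] show ?thesis by (simp add: \<phi>_def)
qed

section \<open>Martingale-coboundary decomposition and the limit theorem\<close>

text \<open>Let L be the transfer. The series that starts at n = 1 satisfies Lg = g - Lf, and L(g o
  T) = g, so in L(f + g - g o T) everything cancels. The L2 decay makes the series converge almost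
  everywhere with square integrable sum.\<close>

lemma gordin_decomposition:
  assumes f [measurable]: "f \<in> borel_measurable M" and f2: "integrable M (\<lambda>x. (f x)\<^sup>2)"
    and q: "0 < q" "q < 1"
    and decay: "\<And>n. (\<integral>x. ((transfer ^^ n) f x)\<^sup>2 \<partial>M) \<le> C * q ^ n"
  obtains g :: "'a \<Rightarrow> real" where "g \<in> borel_measurable M" "integrable M (\<lambda>x. (g x)\<^sup>2)"
    "AE x in M. transfer (\<lambda>x. f x + g x - g (T x)) x = 0"
proof -
  \<comment> \<open>The decay q = r * r is split in two: one factor r^n serves as the Cauchy-Schwarz
    weight, the other keeps the weighted squares \<open>b n\<close> summable in L1.\<close>
  define r where "r = sqrt q"
  have r: "0 < r" "r < 1" "q = r * r" using q by (simp_all add: r_def)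
  define a where "a n = (transfer ^^ Suc n) f" for n
  define b where "b n x = (a n x)\<^sup>2 / r ^ n" for n x
  have [measurable]: "a n \<in> borel_measurable M" for n
    unfolding a_def by (intro transfer_iterate_measurable f)
  have [measurable]: "b n \<in> borel_measurable M" for n unfolding b_def by measurable
  have b0: "b n x \<ge> 0" for n x using r by (simp add: b_def)
  have bi: "integrable M (b n)" for n
    using transfer_L2_contract[OF f f2, of "Suc n"] by (simp add: b_def[abs_def] a_def)
  have C: "0 \<le> C"
  proof -
    have "0 \<le> (\<integral>x. (f x)\<^sup>2 \<partial>M)" by simp
    also have "\<dots> \<le> C" using decay[of 0] by simp
    finally show ?thesis .
  qed
  have b_le: "(\<integral>x. b n x \<partial>M) \<le> C * r ^ n" for n
  proof -
    have "(\<integral>x. b n x \<partial>M) \<le> C * q ^ Suc n / r ^ n"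
      using r decay[of "Suc n"] by (simp add: b_def a_def divide_right_mono)
    also have "\<dots> = C * r ^ n * q" using r by (simp add: power_mult_distrib)
    also have "\<dots> \<le> C * r ^ n" using q r C by (intro mult_right_le_one_le) auto
    finally show ?thesis .
  qed
  have geo: "summable (\<lambda>n. C * r ^ n)" using r by (intro summable_mult summable_geometric) auto
  have "(\<integral>\<^sup>+x. (\<Sum>n. ennreal (b n x)) \<partial>M) = (\<Sum>n. ennreal (\<integral>x. b n x \<partial>M))"
    using b0 by (subst nn_integral_suminf) (auto intro!: suminf_cong nn_integral_eq_integral bi)
  also have "\<dots> \<le> (\<Sum>n. ennreal (C * r ^ n))" by (intro suminf_le ennreal_leI b_le) auto
  also have "\<dots> < \<infinity>"
  proof -
    have "(\<Sum>n. ennreal (C * r ^ n)) \<noteq> top"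
      by (rule ennreal_suminf_neq_top[OF geo]) (use r(1) C in simp)
    then show ?thesis by (simp only: infinity_ennreal_def less_top)
  qed
  finally have "AE x in M. (\<Sum>n. ennreal (b n x)) \<noteq> \<infinity>"
    by (intro nn_integral_PInf_AE) auto
  then have sm: "AE x in M. summable (\<lambda>n. b n x)"
    by eventually_elim (auto intro!: summable_suminf_not_top b0)
  have Gi: "integrable M (\<lambda>x. \<Sum>n. b n x)"
    using sm b0 by (intro integrable_suminf bi summable_comparison_test[OF _ geo])
      (auto intro!: exI[of _ 0] b_le)
  define g where "g x = (\<Sum>n. a n x)" for x
  have [measurable]: "g \<in> borel_measurable M" unfolding g_def by measurable
  have "AE x in M. norm ((g x)\<^sup>2) \<le> norm (1 / (1 - r) * (\<Sum>n. b n x))"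
    using sm
  proof eventually_elim
    case (elim x)
    have "(g x)\<^sup>2 \<le> 1 / (1 - r) * (\<Sum>n. b n x)"
      using weighted_Cauchy_Schwarz_suminf(2)[OF r(1,2) elim[unfolded b_def]] by (simp add: g_def b_def)
    then show ?case unfolding real_norm_def abs_power2 by (rule order_trans[OF _ abs_ge_self])
  qed
  then have g2: "integrable M (\<lambda>x. (g x)\<^sup>2)"
    by (intro Bochner_Integration.integrable_bound[OF integrable_mult_right[OF Gi, of "1 / (1 - r)"]]) auto
  \<comment> \<open>The transfer is taken term by term, which requires convergence of the series at
    x and at both of its preimages; \<open>AE_branch\<close> supplies the latter.\<close>
  have "AE x in M. transfer (\<lambda>x. f x + g x - g (T x)) x = 0"
    using sm AE_branch[OF sm, of True] AE_branch[OF sm, of False] AE_space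
  proof eventually_elim
    case (elim x)
    have s: "summable (\<lambda>n. a n x)" "summable (\<lambda>n. a n (Y True x))" "summable (\<lambda>n. a n (Y False x))"
      by (rule weighted_Cauchy_Schwarz_suminf(1)[OF r(1,2) elim(1)[unfolded b_def]]
          weighted_Cauchy_Schwarz_suminf(1)[OF r(1,2) elim(2)[unfolded b_def]]
          weighted_Cauchy_Schwarz_suminf(1)[OF r(1,2) elim(3)[unfolded b_def]])+
    have "transfer g x = (\<Sum>n. transfer (a n) x)"
      using s by (simp add: half_sum_def g_def suminf_add summable_add flip: suminf_divide)
    also have "\<dots> = (\<Sum>n. a (Suc n) x)" by (simp add: a_def)
    also have "\<dots> = g x - a 0 x" using suminf_split_head[OF s(1)] by (simp add: g_def)
    finally have "transfer g x = g x - a 0 x" .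
    moreover have "a 0 x = transfer f x" by (simp add: a_def)
    ultimately show ?case using elim by (simp add: half_sum_def T_Y field_simps)
  qed
  with g2 show thesis by (intro that[of g]) auto
qed

lemma square_integrable_ergodic_sum:
  assumes [measurable]: "m \<in> borel_measurable M" and m2: "integrable M (\<lambda>x. (m x)\<^sup>2)"
  shows "integrable M (\<lambda>x. (ergodic_sum m n x)\<^sup>2)"
proof (induction n)
  case (Suc n)
  have "integrable M (\<lambda>x. (ergodic_sum m n ((T ^^ 1) x))\<^sup>2)"
    using Suc by (subst integrable_T_iterate[where g = "\<lambda>x. (ergodic_sum m n x)\<^sup>2"]) auto
  then show ?case
    unfolding ergodic_sum_Suc by (intro square_integrable_add m2) auto
qed (simp add: ergodic_sum_def)

text \<open>Orthogonality: the integral of m * (S o T) equals that of the transfer of m times S,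
  which is 0.\<close>

lemma martingale_variance:
  assumes [measurable]: "m \<in> borel_measurable M" and m2: "integrable M (\<lambda>x. (m x)\<^sup>2)"
    and Lm: "AE x in M. transfer m x = 0"
  shows "(\<integral>x. (ergodic_sum m n x)\<^sup>2 \<partial>M) = n * (\<integral>x. (m x)\<^sup>2 \<partial>M)"
proof (induction n)
  case (Suc n)
  let ?S = "ergodic_sum m n"
  have S2: "integrable M (\<lambda>x. (?S x)\<^sup>2)" by (rule square_integrable_ergodic_sum) (use m2 in auto)
  have ST2: "integrable M (\<lambda>x. (?S (T x))\<^sup>2)"
    using S2 integrable_T_iterate[where g = "\<lambda>x. (?S x)\<^sup>2" and n = 1] by simp
  have mix: "integrable M (\<lambda>x. m x * ?S (T x))"
    by (intro square_integrable_mult m2 ST2) auto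
  have "(\<integral>x. m x * ?S (T x) \<partial>M) = (\<integral>x. transfer m x * ?S x \<partial>M)"
    by (rule integral_mult_T(2)[OF mix])
  also have "\<dots> = (\<integral>x. 0 \<partial>M)" using Lm by (intro integral_cong_AE) auto
  finally have mix0: "(\<integral>x. m x * ?S (T x) \<partial>M) = 0" by simp
  have "(\<integral>x. (ergodic_sum m (Suc n) x)\<^sup>2 \<partial>M) = (\<integral>x. (m x)\<^sup>2 + (?S (T x))\<^sup>2 + 2 * (m x * ?S (T x)) \<partial>M)"
    by (simp add: ergodic_sum_Suc power2_sum mult.assoc)
  also have "\<dots> = (\<integral>x. (m x)\<^sup>2 \<partial>M) + (\<integral>x. (?S (T x))\<^sup>2 \<partial>M)"
    using m2 ST2 mix mix0 by simp
  also have "(\<integral>x. (?S (T x))\<^sup>2 \<partial>M) = (\<integral>x. (?S x)\<^sup>2 \<partial>M)"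
    using integral_T_iterate[where g = "\<lambda>x. (?S x)\<^sup>2" and n = 1] by simp
  finally show ?case using Suc by (simp add: distrib_right)
qed (simp add: ergodic_sum_def)

lemma ergodic_sum_coboundary:
  "ergodic_sum f n x = ergodic_sum (\<lambda>x. f x + g x - g (T x)) n x + (g ((T ^^ n) x) - g x)"
  by (induction n) (simp_all add: ergodic_sum_def)

text \<open>Replacing f by m changes the sums by g o T^n - g, bounded in L2 uniformly in n and hence
  negligible after division by sqrt n. Positivity of v is where cohomology enters: v = 0 would force
  m = 0 almost everywhere, making f a coboundary.\<close>

theorem gordin_central_limit:
  assumes f [measurable]: "f \<in> borel_measurable M" and f2: "integrable M (\<lambda>x. (f x)\<^sup>2)"
    and q: "0 < q" "q < 1"
    and decay: "\<And>n. (\<integral>x. ((transfer ^^ n) f x)\<^sup>2 \<partial>M) \<le> C * q ^ n"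
    and exact: "\<And>w :: 'a \<Rightarrow> real. integrable M w \<Longrightarrow> (\<integral>x. w x \<partial>M) = 0 \<Longrightarrow>
      (\<lambda>p. \<integral>x. \<bar>(transfer ^^ p) w x\<bar> \<partial>M) \<longlonglongrightarrow> 0"
    and not_cob: "\<And>g. g \<in> borel_measurable M \<Longrightarrow> integrable M (\<lambda>x. (g x)\<^sup>2) \<Longrightarrow>
      \<not> (AE x in M. f x = g (T x) - g x)"
  obtains v where "0 < v" "(\<lambda>n. (\<integral>x. (ergodic_sum f n x / sqrt n)\<^sup>2 \<partial>M)) \<longlonglongrightarrow> v"
    "\<And>t. (\<lambda>n. \<integral>x. iexp (t / sqrt n * ergodic_sum f n x) \<partial>M) \<longlonglongrightarrow> of_real (exp (- (t\<^sup>2 * v / 2)))"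
proof -
  obtain g :: "'a \<Rightarrow> real" where g [measurable]: "g \<in> borel_measurable M" and g2: "integrable M (\<lambda>x. (g x)\<^sup>2)"
    and Lm: "AE x in M. transfer (\<lambda>x. f x + g x - g (T x)) x = 0"
    using gordin_decomposition[OF f f2 q decay] by blast
  define m where "m x = f x + g x - g (T x)" for x
  have m [measurable]: "m \<in> borel_measurable M" unfolding m_def by measurable
  have g1: "integrable M g" by (rule square_integrable_imp_integrable[OF g g2])
  have gT2: "integrable M (\<lambda>x. (g ((T ^^ n) x))\<^sup>2)" and gT1: "integrable M (\<lambda>x. g ((T ^^ n) x))" for n
    using g2 g1 integrable_T_iterate[where g = "\<lambda>x. (g x)\<^sup>2" and n = n] integrable_T_iterate[OF g, of n] by auto
  have m2: "integrable M (\<lambda>x. (m x)\<^sup>2)"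
    unfolding m_def using gT2[of 1] by (intro square_integrable_diff square_integrable_add f2 g2) auto
  have Lm: "AE x in M. transfer m x = 0" using Lm by (simp add: m_def[abs_def])
  define v where "v = (\<integral>x. (m x)\<^sup>2 \<partial>M)"
  have "v \<noteq> 0"
  proof
    assume "v = 0"
    then have "AE x in M. (m x)\<^sup>2 = 0"
      unfolding v_def using integral_nonneg_eq_0_iff_AE[OF m2] by simp
    then have "AE x in M. f x = g (T x) - g x"
      by eventually_elim (simp add: m_def)
    then show False using not_cob g g2 by blast
  qed
  moreover have "v \<ge> 0" by (simp add: v_def)
  ultimately have "0 < v" by simp
  define R where "R n x = g ((T ^^ n) x) - g x" for n x
  have [measurable]: "R n \<in> borel_measurable M" for n unfolding R_def by measurable
  have Sf: "ergodic_sum f n x = ergodic_sum m n x + R n x" for n x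
    using ergodic_sum_coboundary[of f n x g] by (simp add: m_def[abs_def] R_def)
  define G where "G = (\<integral>x. (g x)\<^sup>2 \<partial>M)"
  have R2i: "integrable M (\<lambda>x. (R n x)\<^sup>2)" for n
    unfolding R_def by (intro square_integrable_diff gT2 g2) auto
  have R2: "(\<integral>x. (R n x)\<^sup>2 \<partial>M) \<le> 4 * G" for n
  proof -
    have "(\<integral>x. (R n x)\<^sup>2 \<partial>M) \<le> (\<integral>x. 2 * (g ((T ^^ n) x))\<^sup>2 + 2 * (g x)\<^sup>2 \<partial>M)"
    proof (intro integral_mono R2i)
      show "integrable M (\<lambda>x. 2 * (g ((T ^^ n) x))\<^sup>2 + 2 * (g x)\<^sup>2)" using gT2[of n] g2 by simp
      show "(R n x)\<^sup>2 \<le> 2 * (g ((T ^^ n) x))\<^sup>2 + 2 * (g x)\<^sup>2" for x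
        using zero_le_power2[of "g ((T ^^ n) x) + g x"] unfolding R_def power2_diff power2_sum by linarith
    qed
    also have "\<dots> = 4 * G"
      using gT2[of n] g2 integral_T_iterate[where g = "\<lambda>x. (g x)\<^sup>2" and n = n] by (simp add: G_def)
    finally show ?thesis .
  qed
  have S2i: "integrable M (\<lambda>x. (ergodic_sum m n x)\<^sup>2)" for n
    by (rule square_integrable_ergodic_sum[OF m m2])
  \<comment> \<open>The cross term is estimated by 2|ab| <= a^2 / sqrt n + sqrt n * b^2: as S^2
    integrates to n * v and R^2 to at most 4 * G, both parts are of order sqrt n.\<close>
  have var: "\<bar>(\<integral>x. (ergodic_sum f n x / sqrt n)\<^sup>2 \<partial>M) - v\<bar> \<le> (v + 4 * G) / sqrt n + 4 * G / n"
    if n: "n > 0" for n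
  proof -
    let ?S = "ergodic_sum m n"
    have div_sqrt: "real n * c / sqrt n = sqrt n * c" for c
      by (subst mult.commute) (simp only: times_divide_eq_right[symmetric] real_div_sqrt of_nat_0_le_iff mult.commute)
    have mixi: "integrable M (\<lambda>x. ?S x * R n x)"
      by (intro square_integrable_mult S2i R2i) auto
    have "\<bar>2 * (\<integral>x. ?S x * R n x \<partial>M)\<bar> \<le> (\<integral>x. \<bar>2 * (?S x * R n x)\<bar> \<partial>M)"
      using integral_abs_bound[of M "\<lambda>x. 2 * (?S x * R n x)"] by simp
    also have "\<dots> \<le> (\<integral>x. (?S x)\<^sup>2 / sqrt n + sqrt n * (R n x)\<^sup>2 \<partial>M)"
    proof (intro integral_mono)
      show "integrable M (\<lambda>x. \<bar>2 * (?S x * R n x)\<bar>)" using mixi by simp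
      show "integrable M (\<lambda>x. (?S x)\<^sup>2 / sqrt n + sqrt n * (R n x)\<^sup>2)" using S2i[of n] R2i[of n] by simp
      show "\<bar>2 * (?S x * R n x)\<bar> \<le> (?S x)\<^sup>2 / sqrt n + sqrt n * (R n x)\<^sup>2" for x
      proof -
        have "0 \<le> (\<bar>?S x\<bar> - sqrt n * \<bar>R n x\<bar>)\<^sup>2 / sqrt n" by simp
        also have "\<dots> = (?S x)\<^sup>2 / sqrt n + sqrt n * (R n x)\<^sup>2 - \<bar>2 * (?S x * R n x)\<bar>"
          using n div_sqrt by (simp add: power2_diff abs_mult power_mult_distrib diff_divide_distrib add_divide_distrib)
        finally show ?thesis by simp
      qed
    qed
    also have "\<dots> = n * v / sqrt n + sqrt n * (\<integral>x. (R n x)\<^sup>2 \<partial>M)"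
      using S2i[of n] R2i[of n] martingale_variance[OF m m2 Lm, of n] by (simp add: v_def)
    also have "\<dots> \<le> n * v / sqrt n + sqrt n * (4 * G)" by (intro add_left_mono mult_left_mono R2) simp
    finally have mix: "\<bar>2 * (\<integral>x. ?S x * R n x \<partial>M)\<bar> \<le> n * v / sqrt n + sqrt n * (4 * G)" .
    have "(\<integral>x. (ergodic_sum f n x)\<^sup>2 \<partial>M) = (\<integral>x. (?S x)\<^sup>2 + (R n x)\<^sup>2 + 2 * (?S x * R n x) \<partial>M)"
      by (simp add: Sf power2_sum mult.assoc)
    also have "\<dots> = n * v + (\<integral>x. (R n x)\<^sup>2 \<partial>M) + 2 * (\<integral>x. ?S x * R n x \<partial>M)"
      using S2i[of n] R2i[of n] mixi martingale_variance[OF m m2 Lm, of n] by (simp add: v_def)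
    finally have eq: "(\<integral>x. (ergodic_sum f n x)\<^sup>2 \<partial>M) - n * v =
        (\<integral>x. (R n x)\<^sup>2 \<partial>M) + 2 * (\<integral>x. ?S x * R n x \<partial>M)" by simp
    have "\<bar>(\<integral>x. (ergodic_sum f n x)\<^sup>2 \<partial>M) - n * v\<bar> \<le> 4 * G + (n * v / sqrt n + sqrt n * (4 * G))"
    proof -
      have "0 \<le> (\<integral>x. (R n x)\<^sup>2 \<partial>M)" by simp
      then show ?thesis unfolding eq using mix R2[of n] by linarith
    qed
    then have "\<bar>(\<integral>x. (ergodic_sum f n x)\<^sup>2 \<partial>M) - n * v\<bar> / n \<le> (4 * G + (n * v / sqrt n + sqrt n * (4 * G))) / n"
      by (intro divide_right_mono) auto
    also have "\<dots> = (v + 4 * G) / sqrt n + 4 * G / n"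
    proof -
      have "sqrt n * c / n = c / sqrt n" for c :: real
        unfolding div_sqrt[symmetric] using n by simp
      then show ?thesis using n by (simp add: add_divide_distrib)
    qed
    also have "\<bar>(\<integral>x. (ergodic_sum f n x)\<^sup>2 \<partial>M) - n * v\<bar> / n = \<bar>(\<integral>x. (ergodic_sum f n x / sqrt n)\<^sup>2 \<partial>M) - v\<bar>"
    proof -
      have "(\<integral>x. (ergodic_sum f n x / sqrt n)\<^sup>2 \<partial>M) - v = ((\<integral>x. (ergodic_sum f n x)\<^sup>2 \<partial>M) - n * v) / n"
        using n by (simp add: power_divide diff_divide_distrib)
      then show ?thesis by (simp only: abs_divide abs_of_nat)
    qed
    finally show ?thesis .
  qed
  have "(\<lambda>n. (v + 4 * G) / sqrt (real n) + 4 * G / n) \<longlonglongrightarrow> 0" by real_asymp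
  then have "(\<lambda>n. (\<integral>x. (ergodic_sum f n x / sqrt n)\<^sup>2 \<partial>M) - v) \<longlonglongrightarrow> 0"
    by (rule Lim_null_comparison[rotated]) (use eventually_gt_at_top[of 0] in eventually_elim, use var in simp)
  then have var_lim: "(\<lambda>n. (\<integral>x. (ergodic_sum f n x / sqrt n)\<^sup>2 \<partial>M)) \<longlonglongrightarrow> v"
    by (rule LIM_zero_cancel)
  have "(\<lambda>n. \<integral>x. iexp (t / sqrt n * ergodic_sum f n x) \<partial>M) \<longlonglongrightarrow> of_real (exp (- (t\<^sup>2 * v / 2)))" for t
  proof -
    define A where "A = (\<integral>x. \<bar>g x\<bar> \<partial>M)"
    \<comment> \<open>Since |exp(ia) - 1| <= |a|, the coboundary moves the characteristic function
      by at most |t| / sqrt n times twice the L1 norm of g.\<close>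
    have bound: "norm ((\<integral>x. iexp (t / sqrt n * ergodic_sum f n x) \<partial>M) - (\<integral>x. iexp (t / sqrt n * ergodic_sum m n x) \<partial>M))
       \<le> \<bar>t\<bar> * 2 * A / sqrt n" for n
    proof -
      let ?s = "t / sqrt n"
      have R1: "integrable M (\<lambda>x. \<bar>?s\<bar> * (\<bar>g ((T ^^ n) x)\<bar> + \<bar>g x\<bar>))" using gT1[of n] g1 by simp
      have "(\<integral>x. iexp (?s * ergodic_sum f n x) \<partial>M) - (\<integral>x. iexp (?s * ergodic_sum m n x) \<partial>M)
        = (\<integral>x. iexp (?s * ergodic_sum f n x) - iexp (?s * ergodic_sum m n x) \<partial>M)"
        by (intro Bochner_Integration.integral_diff[symmetric] integrable_iexp_scale) auto
      also have "norm \<dots> \<le> (\<integral>x. norm (iexp (?s * ergodic_sum f n x) - iexp (?s * ergodic_sum m n x)) \<partial>M)"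
        by (rule integral_norm_bound)
      also have "\<dots> \<le> (\<integral>x. \<bar>?s\<bar> * (\<bar>g ((T ^^ n) x)\<bar> + \<bar>g x\<bar>) \<partial>M)"
      proof (intro integral_mono R1 integrable_norm Bochner_Integration.integrable_diff integrable_iexp_scale)
        fix x
        have "iexp (?s * ergodic_sum f n x) - iexp (?s * ergodic_sum m n x) =
          iexp (?s * ergodic_sum m n x) * (iexp (?s * R n x) - 1)"
          by (simp add: Sf distrib_left exp_add algebra_simps)
        then have "norm (iexp (?s * ergodic_sum f n x) - iexp (?s * ergodic_sum m n x)) = norm (iexp (?s * R n x) - 1)"
          by (simp only: norm_mult norm_exp_i_times mult_1_left)
        also have "\<dots> \<le> \<bar>?s * R n x\<bar>" using iexp_approx1[of "?s * R n x" 0] by (simp del: of_real_mult of_real_divide)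
        also have "\<dots> \<le> \<bar>?s\<bar> * (\<bar>g ((T ^^ n) x)\<bar> + \<bar>g x\<bar>)"
          unfolding R_def abs_mult by (intro mult_left_mono abs_triangle_ineq4) simp
        finally show "norm (iexp (?s * ergodic_sum f n x) - iexp (?s * ergodic_sum m n x)) \<le> \<dots>" .
      qed auto
      also have "\<dots> = \<bar>t\<bar> * 2 * A / sqrt n"
        using gT1[of n] g1 integral_T_iterate[where g = "\<lambda>x. \<bar>g x\<bar>" and n = n] by (simp add: A_def)
      finally show ?thesis .
    qed
    have vanish: "(\<lambda>n. \<bar>t\<bar> * 2 * A / sqrt (real n)) \<longlonglongrightarrow> 0" by real_asymp
    have "(\<lambda>n. (\<integral>x. iexp (t / sqrt n * ergodic_sum f n x) \<partial>M) - (\<integral>x. iexp (t / sqrt n * ergodic_sum m n x) \<partial>M)) \<longlonglongrightarrow> 0"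
      by (rule Lim_null_comparison[OF always_eventually[OF allI[OF bound]] vanish])
    from tendsto_add[OF this martingale_char_limit[OF m m2 Lm exact, of t]]
    show ?thesis by (simp add: v_def)
  qed
  with that \<open>0 < v\<close> var_lim show thesis by blast
qed

end

section \<open>The Boole map\<close>

text \<open>The two roots y of y^2 - 2 x y - 1 = 0, which is \<open>boole_map y = x\<close> cleared
  of its denominator.\<close>

definition cauchy_branch :: "bool \<Rightarrow> real \<Rightarrow> real" where
  "cauchy_branch b x = (if b then x + sqrt (x\<^sup>2 + 1) else x - sqrt (x\<^sup>2 + 1))"

text \<open>For the upper branch this is the half-angle identity tan(a/2 + pi/4) = tan a + sec a
  with a = arctan x, obtained from a vanishing derivative and the value at 0. The lower branch is
  minus the upper one at -x.\<close>

lemma arctan_cauchy_branch: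
  "arctan (cauchy_branch b x) = arctan x / 2 + (if b then pi / 4 else - (pi / 4))"
proof -
  define f where "f x = arctan (x + sqrt (x\<^sup>2 + 1)) - arctan x / 2" for x :: real
  have "DERIV f x :> 0" for x
  proof -
    define w where "w = sqrt (x\<^sup>2 + 1)"
    have w: "w > 0" "w\<^sup>2 = x\<^sup>2 + 1" by (simp_all add: w_def add_nonneg_pos)
    have "w > \<bar>x\<bar>" using real_sqrt_less_mono[of "x\<^sup>2" "x\<^sup>2 + 1"] by (simp add: w_def)
    then have wx: "w + x > 0" by linarith
    have nn: "\<not> 1 + x\<^sup>2 < 0" by (simp add: not_less)
    have "DERIV f x :> (1 + x / w) / (1 + (x + w)\<^sup>2) - 1 / (1 + x\<^sup>2) / 2"
      unfolding f_def w_def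
      by (auto intro!: derivative_eq_intros simp: nn add_nonneg_pos add_pos_nonneg add_nonneg_eq_0_iff field_simps)
    moreover have "1 + (x + w)\<^sup>2 = 2 * w * (w + x)"
      using w(2) by (simp add: power2_eq_square algebra_simps)
    moreover have "1 + x / w = (w + x) / w" using w by (simp add: field_simps)
    moreover have "(w + x) / w / (2 * w * (w + x)) = 1 / (1 + x\<^sup>2) / 2"
      using w wx by (simp add: w(2)[symmetric] add.commute[of 1] power2_eq_square)
    ultimately show ?thesis by simp
  qed
  then have const: "f x = f 0" for x using DERIV_isconst_all by blast
  have *: "arctan (x + sqrt (x\<^sup>2 + 1)) = arctan x / 2 + pi / 4" for x
    using const[of x] unfolding f_def by (simp add: arctan_one)
  have "arctan (x - sqrt (x\<^sup>2 + 1)) = - arctan (- x + sqrt ((- x)\<^sup>2 + 1))"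
    by (subst arctan_minus[symmetric]) simp
  then show ?thesis using *[of x] *[of "-x"] by (simp add: cauchy_branch_def arctan_minus)
qed

lemma boole_map_cauchy_branch: "boole_map (cauchy_branch b x) = x"
proof -
  define w where "w = sqrt (x\<^sup>2 + 1)"
  have w: "w\<^sup>2 = x\<^sup>2 + 1" by (simp add: w_def add_nonneg_pos)
  \<comment> \<open>Strictness keeps both roots away from 0, where \<open>boole_map\<close> has its
    exceptional value.\<close>
  have "w > \<bar>x\<bar>" using real_sqrt_less_mono[of "x\<^sup>2" "x\<^sup>2 + 1"] by (simp add: w_def)
  then have n: "x + w \<noteq> 0" "x - w \<noteq> 0" by linarith+
  define y where "y = cauchy_branch b x"
  have "y = x + w \<or> y = x - w" by (simp add: y_def cauchy_branch_def w_def)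
  then have "y \<noteq> 0" and "y * y - 1 = x * (2 * y)"
    using n w by (auto simp: power2_eq_square algebra_simps)
  moreover have "boole_map y = (y * y - 1) / (2 * y)"
    using \<open>y \<noteq> 0\<close> by (simp add: boole_map_def diff_divide_distrib)
  ultimately show ?thesis by (simp add: y_def)
qed

section \<open>The Cauchy distribution and its invariance\<close>

lemma sets_cauchy_measure [measurable_cong, simp]: "sets cauchy_measure = sets borel"
  and space_cauchy_measure [simp]: "space cauchy_measure = UNIV"
  by (simp_all add: cauchy_measure_def)

text \<open>The density has antiderivative arctan x / pi. Extended endpoints let one computation
  serve half-lines and the whole line.\<close>

lemma emeasure_cauchy_einterval:
  fixes a b :: ereal
  assumes ab: "a < b"
    and A: "(((\<lambda>x. arctan x / pi) \<circ> real_of_ereal) \<longlongrightarrow> A) (at_right a)"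
    and B: "(((\<lambda>x. arctan x / pi) \<circ> real_of_ereal) \<longlongrightarrow> B) (at_left b)"
  shows "emeasure cauchy_measure (einterval a b) = ennreal (B - A)"
proof -
  let ?f = "\<lambda>x::real. 1 / (pi * (x\<^sup>2 + 1))"
  have pos: "x\<^sup>2 + 1 \<noteq> 0" for x :: real by (metis add.commute power_one sum_power2_eq_zero_iff zero_neq_one)
  have d: "DERIV (\<lambda>x. arctan x / pi) x :> ?f x" for x
    using DERIV_cdivide[OF DERIV_arctan, of pi x]
    by (simp add: divide_inverse mult.commute add.commute)
  have c: "isCont ?f x" for x
    using pos[of x] by (intro continuous_intros) auto
  note F = interval_integral_FTC_nonneg[OF ab d c _ A B]
  have si: "set_integrable lborel (einterval a b) ?f" and I: "(LBINT x=a..b. ?f x) = B - A"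
    by (rule F, auto)+
  have [measurable]: "einterval a b \<in> sets borel" by simp
  have "emeasure cauchy_measure (einterval a b) = (\<integral>\<^sup>+x. ennreal (?f x) * indicator (einterval a b) x \<partial>lborel)"
    unfolding cauchy_measure_def by (subst emeasure_density) auto
  also have "\<dots> = (\<integral>\<^sup>+x. ennreal (indicator (einterval a b) x *\<^sub>R ?f x) \<partial>lborel)"
    by (intro nn_integral_cong) (auto simp: indicator_def)
  also have "\<dots> = ennreal (LBINT x=a..b. ?f x)"
    using si ab unfolding set_integrable_def interval_lebesgue_integral_def set_lebesgue_integral_def
    by (subst nn_integral_eq_integral) auto
  finally show ?thesis using I by simp
qed

lemma emeasure_cauchy_lessThan: "emeasure cauchy_measure {..<t} = ennreal (arctan t / pi + 1 / 2)"
proof -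
  have "einterval (-\<infinity>) (ereal t) = {..<t}" by (auto simp: einterval_def)
  moreover have "emeasure cauchy_measure (einterval (-\<infinity>) (ereal t)) = ennreal (arctan t / pi - (- (pi / 2)) / pi)"
  proof (rule emeasure_cauchy_einterval)
    show "(((\<lambda>x. arctan x / pi) \<circ> real_of_ereal) \<longlongrightarrow> - (pi / 2) / pi) (at_right (- \<infinity>))"
      unfolding ereal_tendsto_simps by (intro tendsto_intros tendsto_arctan_at_bot) auto
    show "(((\<lambda>x. arctan x / pi) \<circ> real_of_ereal) \<longlongrightarrow> arctan t / pi) (at_left (ereal t))"
      unfolding ereal_tendsto_simps by (intro tendsto_intros) auto
  qed auto
  ultimately show ?thesis by simp
qed

lemma prob_space_cauchy: "prob_space cauchy_measure"
proof (rule prob_spaceI)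
  have "einterval (-\<infinity>) \<infinity> = (UNIV :: real set)" by (auto simp: einterval_def)
  moreover have "emeasure cauchy_measure (einterval (-\<infinity>) \<infinity>) = ennreal (pi / 2 / pi - (- (pi / 2)) / pi)"
  proof (rule emeasure_cauchy_einterval)
    show "(((\<lambda>x. arctan x / pi) \<circ> real_of_ereal) \<longlongrightarrow> - (pi / 2) / pi) (at_right (- \<infinity>))"
      unfolding ereal_tendsto_simps by (intro tendsto_intros tendsto_arctan_at_bot) auto
    show "(((\<lambda>x. arctan x / pi) \<circ> real_of_ereal) \<longlongrightarrow> pi / 2 / pi) (at_left \<infinity>)"
      unfolding ereal_tendsto_simps by (intro tendsto_intros tendsto_arctan_at_top) auto
  qed auto
  ultimately show "emeasure cauchy_measure (space cauchy_measure) = 1" by simp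
qed

lemma real_distribution_cauchy: "real_distribution cauchy_measure"
  by (simp add: real_distribution_def real_distribution_axioms_def prob_space_cauchy)

text \<open>In the coordinate arctan x the measure is uniform on (-pi/2, pi/2). Clipping makes the
  formula valid for all s, since the thresholds 2 * arctan t - pi/2 and 2 * arctan t + pi/2 of the
  two branches may fall outside that interval.\<close>

lemma measure_cauchy_arctan_le:
  "measure cauchy_measure {x. arctan x \<le> s} = min 1 (max 0 (s / pi + 1 / 2))"
proof -
  interpret prob_space cauchy_measure by (rule prob_space_cauchy)
  consider "s \<le> - (pi / 2)" | "- (pi / 2) < s" "s < pi / 2" | "pi / 2 \<le> s" by linarith
  then show ?thesis
  proof cases
    case 1
    then have "{x. arctan x \<le> s} = {}" using arctan_lbound by (auto simp: not_le intro: le_less_trans)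
    moreover have "s / pi + 1 / 2 \<le> 0" using 1 pi_gt_zero by (simp add: field_simps)
    ultimately show ?thesis by simp
  next
    case 2
    then have s: "arctan (tan s) = s" by (simp add: arctan_tan)
    have "{x. arctan x \<le> s} = {..tan s}" using arctan_le_iff[of _ "tan s"] by (auto simp: s)
    moreover have "emeasure cauchy_measure {..tan s} = emeasure cauchy_measure {..<tan s}"
    proof -
      have "AE x in lborel. x \<noteq> tan s" by (rule AE_lborel_singleton)
      then have "AE x in cauchy_measure. x \<noteq> tan s"
        unfolding cauchy_measure_def by (subst AE_density) auto
      then show ?thesis by (intro emeasure_eq_AE) auto
    qed
    moreover have "0 \<le> s / pi + 1 / 2" "s / pi + 1 / 2 \<le> 1"
      using 2 pi_gt_zero by (simp_all add: field_simps)
    ultimately show ?thesis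
      by (simp add: measure_def emeasure_cauchy_lessThan s)
  next
    case 3
    then have "arctan x \<le> s" for x using arctan_ubound[of x] by linarith
    then have "{x. arctan x \<le> s} = UNIV" by auto
    moreover have "s / pi + 1 / 2 \<ge> 1" using 3 pi_gt_zero by (simp add: field_simps)
    ultimately show ?thesis using prob_space by simp
  qed
qed

lemma cauchy_branch_measurable [measurable]: "cauchy_branch b \<in> borel_measurable borel"
  unfolding cauchy_branch_def by measurable

lemma boole_map_measurable [measurable]: "boole_map \<in> borel_measurable borel"
  unfolding boole_map_def by measurable

lemma distr_cauchy_branches:
  "distr (measure_pmf (bernoulli_pmf (1/2)) \<Otimes>\<^sub>M cauchy_measure) cauchy_measure
     (\<lambda>(b, x). cauchy_branch b x) = cauchy_measure"
proof -
  let ?B = "measure_pmf (bernoulli_pmf (1/2))"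
  let ?Y = "\<lambda>(b, x). cauchy_branch b x"
  interpret M: prob_space cauchy_measure by (rule prob_space_cauchy)
  interpret P: pair_prob_space ?B cauchy_measure ..
  have "?Y \<in> measurable (count_space UNIV \<Otimes>\<^sub>M cauchy_measure) borel"
    by (intro measurable_pair_measure_countable1) auto
  moreover have "sets (?B \<Otimes>\<^sub>M cauchy_measure) = sets (count_space UNIV \<Otimes>\<^sub>M cauchy_measure)"
    by (intro sets_pair_measure_cong) auto
  ultimately have [measurable]: "?Y \<in> measurable (?B \<Otimes>\<^sub>M cauchy_measure) borel"
    using measurable_cong_sets[of "?B \<Otimes>\<^sub>M cauchy_measure" _ borel borel] by blast
  have N: "real_distribution (distr (?B \<Otimes>\<^sub>M cauchy_measure) borel ?Y)"
    by (rule P.real_distribution_distr) simp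
  have "cdf (distr (?B \<Otimes>\<^sub>M cauchy_measure) borel ?Y) t = cdf cauchy_measure t" for t
  proof -
    let ?A = "?Y -` {..t} \<inter> space (?B \<Otimes>\<^sub>M cauchy_measure)"
    have A: "?A \<in> sets (?B \<Otimes>\<^sub>M cauchy_measure)" by measurable
    have sec: "Pair b -` ?A = {x. cauchy_branch b x \<le> t}" for b
      by (auto simp: space_pair_measure)
    have arc: "{x. cauchy_branch b x \<le> t} = {x. arctan x \<le> 2 * arctan t - (if b then pi / 2 else - (pi / 2))}" for b
    proof -
      have "cauchy_branch b x \<le> t \<longleftrightarrow> arctan (cauchy_branch b x) \<le> arctan t" for x
        by (simp only: arctan_le_iff)
      then show ?thesis unfolding arctan_cauchy_branch by (auto simp: field_simps)
    qed
    have F: "- (pi / 2) < arctan t" "arctan t < pi / 2" by (rule arctan_lbound arctan_ubound)+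
    have "emeasure (?B \<Otimes>\<^sub>M cauchy_measure) ?A = (\<integral>\<^sup>+b. emeasure cauchy_measure (Pair b -` ?A) \<partial>?B)"
      by (rule M.emeasure_pair_measure_alt[OF A])
    also have "\<dots> = (\<integral>\<^sup>+b. ennreal (measure cauchy_measure {x. cauchy_branch b x \<le> t}) \<partial>?B)"
      unfolding sec M.emeasure_eq_measure ..
    also have "\<dots> = ennreal (\<integral>b. measure cauchy_measure {x. cauchy_branch b x \<le> t} \<partial>?B)"
      by (intro nn_integral_eq_integral integrable_measure_pmf_finite) auto
    finally have "measure (?B \<Otimes>\<^sub>M cauchy_measure) ?A = (\<integral>b. measure cauchy_measure {x. cauchy_branch b x \<le> t} \<partial>?B)"
      by (intro measure_eq_emeasure_eq_ennreal Bochner_Integration.integral_nonneg) auto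
    also have "\<dots> = (min 1 (max 0 (2 * arctan t / pi)) + min 1 (max 0 (2 * arctan t / pi + 1))) / 2"
      unfolding arc measure_cauchy_arctan_le
      by (simp add: integral_measure_pmf[of UNIV] UNIV_bool diff_divide_distrib add_divide_distrib)
    \<comment> \<open>For each t one of the two terms is clipped, the first to 0 if t <= 0, the
      second to 1 if t >= 0; the other carries the dependence on t.\<close>
    also have "\<dots> = arctan t / pi + 1 / 2"
    proof -
      have "arctan t / pi < 1 / 2" "- 1 / 2 < arctan t / pi" using F pi_gt_zero by (simp_all add: field_simps)
      then show ?thesis by (auto simp: min_def max_def)
    qed
    also have "\<dots> = measure cauchy_measure {x. arctan x \<le> arctan t}"
    proof -
      have "arctan t / pi < 1 / 2" "- 1 / 2 < arctan t / pi" using F pi_gt_zero by (simp_all add: field_simps)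
      then show ?thesis unfolding measure_cauchy_arctan_le by linarith
    qed
    finally show ?thesis
      by (simp add: cdf_def measure_distr arctan_le_iff atMost_def)
  qed
  then have "distr (?B \<Otimes>\<^sub>M cauchy_measure) borel ?Y = cauchy_measure"
    by (intro cdf_unique N real_distribution_cauchy ext)
  then show ?thesis
    using distr_cong[of "?B \<Otimes>\<^sub>M cauchy_measure" "?B \<Otimes>\<^sub>M cauchy_measure" cauchy_measure borel ?Y ?Y] by simp
qed

interpretation cauchy: two_branch_system cauchy_measure boole_map cauchy_branch
proof -
  interpret prob_space cauchy_measure by (rule prob_space_cauchy)
  show "two_branch_system cauchy_measure boole_map cauchy_branch"
    by unfold_locales (auto simp: boole_map_cauchy_branch distr_cauchy_branches)
qed

section \<open>Exactness\<close>

lemma borel_measurable_cauchy [simp]: "borel_measurable cauchy_measure = borel_measurable borel"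
  by (rule measurable_cong_sets) simp_all

lemma measure_cauchy_UNIV [simp]: "measure cauchy_measure UNIV = 1"
  using cauchy.prob_space by simp

lemma half_sum_iterate_linear:
  fixes f g :: "'a \<Rightarrow> real"
  shows "(half_sum Y ^^ n) (\<lambda>x. c * f x + d * g x) = (\<lambda>x. c * (half_sum Y ^^ n) f x + d * (half_sum Y ^^ n) g x)"
  by (induction n) (simp_all add: half_sum_def fun_eq_iff algebra_simps add_divide_distrib)

lemma half_sum_iterate_const: "(half_sum Y ^^ n) (\<lambda>_. c :: real) = (\<lambda>_. c)"
  by (induction n) (simp_all add: half_sum_def fun_eq_iff)

lemma half_sum_iterate_diff:
  fixes f g :: "'a \<Rightarrow> real"
  shows "(half_sum Y ^^ n) (\<lambda>x. f x - g x) = (\<lambda>x. (half_sum Y ^^ n) f x - (half_sum Y ^^ n) g x)"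
  using half_sum_iterate_linear[where c = 1 and d = "-1"] by simp

text \<open>Lipschitz for the metric pulled back along arctan. The line has diameter at most pi in
  it, so these functions are bounded.\<close>

definition arctan_lipschitz :: "real \<Rightarrow> (real \<Rightarrow> real) \<Rightarrow> bool" where
  "arctan_lipschitz L g \<longleftrightarrow> (\<forall>x y. \<bar>g x - g y\<bar> \<le> L * \<bar>arctan x - arctan y\<bar>)"

lemma arctan_lipschitz_transfer:
  assumes "arctan_lipschitz L g"
  shows "arctan_lipschitz (L / 2 ^ n) ((cauchy.transfer ^^ n) g)"
proof (induction n)
  case (Suc n)
  let ?g = "(cauchy.transfer ^^ n) g"
  have "\<bar>cauchy.transfer ?g x - cauchy.transfer ?g y\<bar> \<le> L / 2 ^ Suc n * \<bar>arctan x - arctan y\<bar>" for x y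
  proof -
    have step: "\<bar>?g (cauchy_branch b x) - ?g (cauchy_branch b y)\<bar> \<le> L / 2 ^ n * (\<bar>arctan x - arctan y\<bar> / 2)" for b
    proof -
      have "\<bar>arctan (cauchy_branch b x) - arctan (cauchy_branch b y)\<bar> = \<bar>arctan x - arctan y\<bar> / 2"
        unfolding arctan_cauchy_branch by (simp add: abs_if field_simps)
      then show ?thesis using Suc unfolding arctan_lipschitz_def by metis
    qed
    have "\<bar>cauchy.transfer ?g x - cauchy.transfer ?g y\<bar> \<le>
      (\<bar>?g (cauchy_branch True x) - ?g (cauchy_branch True y)\<bar> +
       \<bar>?g (cauchy_branch False x) - ?g (cauchy_branch False y)\<bar>) / 2"
    proof -
      have "\<bar>(1/2) * (a + b) - (1/2) * (c + d)\<bar> \<le> (\<bar>a - c\<bar> + \<bar>b - d\<bar>) / 2" for a b c d :: real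
      proof -
        have "(1/2) * (a + b) - (1/2) * (c + d) = ((a - c) + (b - d)) / 2" by (simp add: field_simps)
        then show ?thesis using abs_triangle_ineq[of "a - c" "b - d"] by (simp only: abs_divide) simp
      qed
      then show ?thesis unfolding half_sum_def[of _ ?g] real_scaleR_def .
    qed
    also have "\<dots> \<le> L / 2 ^ n * (\<bar>arctan x - arctan y\<bar> / 2)"
      using step[of True] step[of False] by argo
    finally show ?thesis by simp
  qed
  then show ?case by (simp add: arctan_lipschitz_def)
qed (use assms in simp)

lemma abs_arctan_diff_le: "\<bar>arctan x - arctan y\<bar> \<le> pi"
  using arctan_bounded[of x] arctan_bounded[of y] by (simp add: abs_le_iff)

lemma arctan_lipschitz_bound:
  assumes "arctan_lipschitz L g" "0 \<le> L"
  shows "\<bar>g x - g y\<bar> \<le> L * pi"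
  using assms mult_left_mono[OF abs_arctan_diff_le[of x y], of L] unfolding arctan_lipschitz_def
  by (meson order_trans)

lemma arctan_lipschitz_integrable:
  assumes "arctan_lipschitz L g" "0 \<le> L" "g \<in> borel_measurable borel"
  shows "integrable cauchy_measure g"
proof (rule cauchy.integrable_const_bound)
  show "AE x in cauchy_measure. norm (g x) \<le> \<bar>g 0\<bar> + L * pi"
    using arctan_lipschitz_bound[OF assms(1,2), of _ 0] by (intro AE_I2) (smt (verit) real_norm_def)
qed (use assms(3) in simp)

text \<open>The transfer preserves the integral, so the mean of g is an average of values of its
  n-th transfer, whose oscillation is at most L * pi / 2^n.\<close>

lemma arctan_lipschitz_transfer_uniform:
  assumes g: "arctan_lipschitz L g" "0 \<le> L" "g \<in> borel_measurable borel"
  shows "\<bar>(cauchy.transfer ^^ n) g x - (\<integral>x. g x \<partial>cauchy_measure)\<bar> \<le> L * pi / 2 ^ n"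
proof -
  let ?g = "(cauchy.transfer ^^ n) g"
  have gi: "integrable cauchy_measure g" by (rule arctan_lipschitz_integrable[OF g])
  then have gni: "integrable cauchy_measure ?g" by (rule cauchy.integrable_transfer_iterate)
  have "?g x - (\<integral>x. g x \<partial>cauchy_measure) = (\<integral>y. ?g x - ?g y \<partial>cauchy_measure)"
    using gni cauchy.integral_transfer_iterate[OF gi, of n] by (simp add: cauchy.prob_space)
  then have "\<bar>?g x - (\<integral>x. g x \<partial>cauchy_measure)\<bar> \<le> (\<integral>y. \<bar>?g x - ?g y\<bar> \<partial>cauchy_measure)"
    by (simp only: integral_abs_bound)
  also have "\<dots> \<le> (\<integral>y. L / 2 ^ n * pi \<partial>cauchy_measure)"
  proof (intro integral_mono)
    show "integrable cauchy_measure (\<lambda>y. \<bar>?g x - ?g y\<bar>)"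
      by (intro integrable_abs Bochner_Integration.integrable_diff gni cauchy.integrable_const)
    show "\<bar>?g x - ?g y\<bar> \<le> L / 2 ^ n * pi" for y
      by (rule arctan_lipschitz_bound[OF arctan_lipschitz_transfer[OF g(1)]]) (use g(2) in simp)
  qed simp
  finally show ?thesis by (simp add: cauchy.prob_space)
qed

text \<open>The mean is subtracted after the transfer, so that the class can contain constants and
  indicators and be closed under linear combinations and limits.\<close>

definition equidistributing :: "(real \<Rightarrow> real) \<Rightarrow> bool" where
  "equidistributing w \<longleftrightarrow> integrable cauchy_measure w \<and>
     (\<lambda>p. \<integral>x. \<bar>(cauchy.transfer ^^ p) w x - (\<integral>x. w x \<partial>cauchy_measure)\<bar> \<partial>cauchy_measure) \<longlonglongrightarrow> 0"

lemma equidistributing_linear: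
  assumes "equidistributing f" "equidistributing g"
  shows "equidistributing (\<lambda>x. c * f x + d * g x)"
proof -
  let ?I = "\<lambda>w. \<integral>x. w x \<partial>cauchy_measure"
  let ?D = "\<lambda>w p x. (cauchy.transfer ^^ p) w x - ?I w"
  have i: "integrable cauchy_measure f" "integrable cauchy_measure g"
    using assms by (simp_all add: equidistributing_def)
  have bound: "norm (?I (\<lambda>x. \<bar>?D (\<lambda>x. c * f x + d * g x) p x\<bar>)) \<le> \<bar>c\<bar> * ?I (\<lambda>x. \<bar>?D f p x\<bar>) + \<bar>d\<bar> * ?I (\<lambda>x. \<bar>?D g p x\<bar>)" for p
  proof -
    have fi: "integrable cauchy_measure (?D f p)" and gi: "integrable cauchy_measure (?D g p)"
      using i by (simp_all add: cauchy.integrable_transfer_iterate)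
    have eq: "?D (\<lambda>x. c * f x + d * g x) p x = c * ?D f p x + d * ?D g p x" for x
      using i by (simp add: half_sum_iterate_linear algebra_simps)
    have "?I (\<lambda>x. \<bar>?D (\<lambda>x. c * f x + d * g x) p x\<bar>) \<le> ?I (\<lambda>x. \<bar>c\<bar> * \<bar>?D f p x\<bar> + \<bar>d\<bar> * \<bar>?D g p x\<bar>)"
      unfolding eq
    proof (intro integral_mono)
      show "\<bar>c * ?D f p x + d * ?D g p x\<bar> \<le> \<bar>c\<bar> * \<bar>?D f p x\<bar> + \<bar>d\<bar> * \<bar>?D g p x\<bar>" for x
        by (rule order_trans[OF abs_triangle_ineq]) (simp add: abs_mult)
    qed (intro integrable_abs Bochner_Integration.integrable_add integrable_mult_right fi gi)+
    also have "\<dots> = \<bar>c\<bar> * ?I (\<lambda>x. \<bar>?D f p x\<bar>) + \<bar>d\<bar> * ?I (\<lambda>x. \<bar>?D g p x\<bar>)"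
      using integrable_abs[OF fi] integrable_abs[OF gi] by simp
    finally show ?thesis by simp
  qed
  have "(\<lambda>p. \<bar>c\<bar> * ?I (\<lambda>x. \<bar>?D f p x\<bar>) + \<bar>d\<bar> * ?I (\<lambda>x. \<bar>?D g p x\<bar>)) \<longlonglongrightarrow> \<bar>c\<bar> * 0 + \<bar>d\<bar> * 0"
    using assms unfolding equidistributing_def by (intro tendsto_intros) auto
  then have "(\<lambda>p. \<bar>c\<bar> * ?I (\<lambda>x. \<bar>?D f p x\<bar>) + \<bar>d\<bar> * ?I (\<lambda>x. \<bar>?D g p x\<bar>)) \<longlonglongrightarrow> 0" by simp
  from Lim_null_comparison[OF always_eventually[OF allI[OF bound]] this] i
  show ?thesis by (simp add: equidistributing_def)
qed

text \<open>The transfer contracts L1, so replacing w by \<open>s i\<close> costs at most twice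
  their distance, uniformly in p: once for the transferred function and once for the mean. Hence i
  can be chosen before p, and the speed for \<open>s i\<close> may depend on i.\<close>

lemma equidistributing_L1_limit:
  assumes s: "\<And>i. equidistributing (s i)" and w: "integrable cauchy_measure w"
    and lim: "(\<lambda>i. \<integral>x. \<bar>w x - s i x\<bar> \<partial>cauchy_measure) \<longlonglongrightarrow> 0"
  shows "equidistributing w"
proof -
  let ?I = "\<lambda>w. \<integral>x. w x \<partial>cauchy_measure"
  let ?L = "cauchy.transfer"
  have si: "integrable cauchy_measure (s i)" for i using s by (simp add: equidistributing_def)
  have key: "?I (\<lambda>x. \<bar>(?L ^^ p) w x - ?I w\<bar>) \<le> 2 * ?I (\<lambda>x. \<bar>w x - s i x\<bar>) + ?I (\<lambda>x. \<bar>(?L ^^ p) (s i) x - ?I (s i)\<bar>)" for i p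
  proof -
    have d: "integrable cauchy_measure (\<lambda>x. w x - s i x)" using w si by simp
    have 1: "integrable cauchy_measure (\<lambda>x. \<bar>(?L ^^ p) (\<lambda>x. w x - s i x) x\<bar>)"
      by (intro integrable_abs cauchy.integrable_transfer_iterate d)
    have 2: "integrable cauchy_measure (\<lambda>x. \<bar>(?L ^^ p) (s i) x - ?I (s i)\<bar>)"
      by (intro integrable_abs Bochner_Integration.integrable_diff cauchy.integrable_transfer_iterate si) simp
    have "?I (\<lambda>x. \<bar>(?L ^^ p) w x - ?I w\<bar>) \<le>
       ?I (\<lambda>x. \<bar>(?L ^^ p) (\<lambda>x. w x - s i x) x\<bar> + \<bar>(?L ^^ p) (s i) x - ?I (s i)\<bar> + \<bar>?I (s i) - ?I w\<bar>)"
    proof (intro integral_mono)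
      show "integrable cauchy_measure (\<lambda>x. \<bar>(?L ^^ p) w x - ?I w\<bar>)"
        by (intro integrable_abs Bochner_Integration.integrable_diff cauchy.integrable_transfer_iterate w) simp
      show "\<bar>(?L ^^ p) w x - ?I w\<bar> \<le> \<bar>(?L ^^ p) (\<lambda>x. w x - s i x) x\<bar> + \<bar>(?L ^^ p) (s i) x - ?I (s i)\<bar> + \<bar>?I (s i) - ?I w\<bar>" for x
        unfolding half_sum_iterate_diff by linarith
    qed (use 1 2 in simp)
    also have "\<dots> = ?I (\<lambda>x. \<bar>(?L ^^ p) (\<lambda>x. w x - s i x) x\<bar>) + ?I (\<lambda>x. \<bar>(?L ^^ p) (s i) x - ?I (s i)\<bar>) + \<bar>?I (s i) - ?I w\<bar>"
      using 1 2 by (simp add: cauchy.prob_space)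
    also have "?I (\<lambda>x. \<bar>(?L ^^ p) (\<lambda>x. w x - s i x) x\<bar>) \<le> ?I (\<lambda>x. \<bar>w x - s i x\<bar>)"
      by (rule cauchy.transfer_L1_contract[OF d])
    also have "\<bar>?I (s i) - ?I w\<bar> \<le> ?I (\<lambda>x. \<bar>w x - s i x\<bar>)"
      using integral_abs_bound[of cauchy_measure "\<lambda>x. w x - s i x"] w si by (simp add: abs_minus_commute)
    finally show ?thesis by simp
  qed
  have "(\<lambda>p. ?I (\<lambda>x. \<bar>(?L ^^ p) w x - ?I w\<bar>)) \<longlonglongrightarrow> 0"
  proof (rule order_tendstoI)
    fix a :: real assume "a < 0"
    then show "\<forall>\<^sub>F p in sequentially. a < ?I (\<lambda>x. \<bar>(?L ^^ p) w x - ?I w\<bar>)"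
      by (intro always_eventually allI less_le_trans[OF _ Bochner_Integration.integral_nonneg]) auto
  next
    fix a :: real assume a: "0 < a"
    have "\<forall>\<^sub>F i in sequentially. ?I (\<lambda>x. \<bar>w x - s i x\<bar>) < a / 4"
      using a by (intro order_tendstoD(2)[OF lim]) simp
    then obtain i where i: "?I (\<lambda>x. \<bar>w x - s i x\<bar>) < a / 4" by (auto simp: eventually_sequentially)
    have "\<forall>\<^sub>F p in sequentially. ?I (\<lambda>x. \<bar>(?L ^^ p) (s i) x - ?I (s i)\<bar>) < a / 4"
      using a s[of i] by (intro order_tendstoD(2)[of _ 0]) (simp_all add: equidistributing_def)
    then show "\<forall>\<^sub>F p in sequentially. ?I (\<lambda>x. \<bar>(?L ^^ p) w x - ?I w\<bar>) < a"
    proof eventually_elim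
      case (elim p)
      then show ?case using key[of p i] i a by linarith
    qed
  qed
  with w show ?thesis by (simp add: equidistributing_def)
qed

lemma equidistributing_dominated_limit:
  assumes s: "\<And>i. equidistributing (s i)" and w: "integrable cauchy_measure w"
    and lim: "\<And>x. (\<lambda>i. s i x) \<longlonglongrightarrow> w x"
    and b: "integrable cauchy_measure b" "\<And>i x. \<bar>s i x\<bar> \<le> b x"
  shows "equidistributing w"
proof (rule equidistributing_L1_limit[OF s w])
  have "(\<lambda>i. \<integral>x. \<bar>w x - s i x\<bar> \<partial>cauchy_measure) \<longlonglongrightarrow> (\<integral>x. 0 \<partial>cauchy_measure)"
  proof (rule integral_dominated_convergence)
    have "s i \<in> borel_measurable cauchy_measure" for i
      using s[of i] by (auto simp: equidistributing_def simp del: borel_measurable_cauchy)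
    with w show "(\<lambda>x. \<bar>w x - s i x\<bar>) \<in> borel_measurable cauchy_measure" for i by auto
    show "integrable cauchy_measure (\<lambda>x. \<bar>w x\<bar> + b x)" using w b by simp
    show "AE x in cauchy_measure. (\<lambda>i. \<bar>w x - s i x\<bar>) \<longlonglongrightarrow> 0"
      using tendsto_diff[OF tendsto_const lim, of "w x" x for x] by (intro AE_I2 tendsto_rabs_zero) simp
    show "AE x in cauchy_measure. norm \<bar>w x - s i x\<bar> \<le> \<bar>w x\<bar> + b x" for i
      using b(2)[of i] by (intro AE_I2) (smt (verit) real_norm_def)
  qed simp
  then show "(\<lambda>i. \<integral>x. \<bar>w x - s i x\<bar> \<partial>cauchy_measure) \<longlonglongrightarrow> 0" by simp
qed

lemma arctan_lipschitz_equidistributing: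
  assumes g: "arctan_lipschitz L g" "0 \<le> L" "g \<in> borel_measurable borel"
  shows "equidistributing g"
proof -
  have gi: "integrable cauchy_measure g" by (rule arctan_lipschitz_integrable[OF g])
  have bound: "norm (\<integral>x. \<bar>(cauchy.transfer ^^ p) g x - (\<integral>x. g x \<partial>cauchy_measure)\<bar> \<partial>cauchy_measure) \<le> L * pi / 2 ^ p" for p
  proof -
    have "(\<integral>x. \<bar>(cauchy.transfer ^^ p) g x - (\<integral>x. g x \<partial>cauchy_measure)\<bar> \<partial>cauchy_measure)
      \<le> (\<integral>x. L * pi / 2 ^ p \<partial>cauchy_measure)"
      using gi by (intro integral_mono arctan_lipschitz_transfer_uniform[OF g] integrable_abs
          Bochner_Integration.integrable_diff cauchy.integrable_transfer_iterate) auto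
    then show ?thesis by (simp add: cauchy.prob_space)
  qed
  have "(\<lambda>p. L * pi / 2 ^ p) \<longlonglongrightarrow> 0" by real_asymp
  from Lim_null_comparison[OF always_eventually[OF allI[OF bound]] this] gi
  show ?thesis by (simp add: equidistributing_def)
qed

lemma equidistributing_atMost: "equidistributing (indicator {..t})"
proof (rule equidistributing_dominated_limit)
  \<comment> \<open>Ramps of slope i in arctan x: equal to 1 up to t, and equal to 0 once i *
    (arctan x - arctan t) reaches 1.\<close>
  define s where "s i x = max 0 (min 1 (1 + real i * (arctan t - arctan x)))" for i x
  show "equidistributing (s i)" for i
  proof (rule arctan_lipschitz_equidistributing)
    have clip: "\<bar>max 0 (min 1 a) - max 0 (min 1 b)\<bar> \<le> \<bar>a - b\<bar>" for a b :: real by linarith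
    have "\<bar>s i x - s i y\<bar> \<le> real i * \<bar>arctan x - arctan y\<bar>" for x y
    proof -
      have "\<bar>s i x - s i y\<bar> \<le> \<bar>real i * (arctan y - arctan x)\<bar>"
        unfolding s_def by (rule order_trans[OF clip]) (simp add: algebra_simps)
      then show ?thesis by (simp add: abs_mult abs_minus_commute)
    qed
    then show "arctan_lipschitz (real i) (s i)" by (simp add: arctan_lipschitz_def)
    have "continuous_on UNIV (s i)" unfolding s_def by (intro continuous_intros)
    then show "s i \<in> borel_measurable borel" by (rule borel_measurable_continuous_onI)
  qed simp
  show "(\<lambda>i. s i x) \<longlonglongrightarrow> indicator {..t} x" for x
  proof (cases "x \<le> t")
    case True
    then have "arctan x \<le> arctan t" by (simp add: arctan_le_iff)
    then have "s i x = 1" for i by (simp add: s_def)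
    then show ?thesis using True by simp
  next
    case False
    define d where "d = arctan x - arctan t"
    have d: "d > 0" using False by (simp add: d_def arctan_less_iff)
    have "\<forall>\<^sub>F i in sequentially. real i > 1 / d"
      using filterlim_real_sequentially by (rule filterlim_at_top_dense[THEN iffD1, rule_format])
    then have "\<forall>\<^sub>F i in sequentially. s i x = 0"
    proof eventually_elim
      case (elim i)
      then have "1 < real i * d" using d by (simp add: field_simps)
      moreover have "real i * (arctan t - arctan x) = - (real i * d)" by (simp add: d_def algebra_simps)
      ultimately show ?case unfolding s_def by simp
    qed
    then show ?thesis using False by (intro tendsto_eventually) simp
  qed
  show "\<bar>s i x\<bar> \<le> 1" for i x by (simp add: s_def)
qed (auto intro!: cauchy.integrable_const_bound[of _ 1] simp: indicator_def)

text \<open>Dynkin argument: half-lines are stable under intersection and generate the Borel sets;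
  complements come from linearity, countable disjoint unions from dominated limits of finite
  ones.\<close>

lemma equidistributing_indicator:
  assumes "A \<in> sets borel"
  shows "equidistributing (indicator A)"
proof -
  have one: "equidistributing (\<lambda>_. 1)"
    by (rule arctan_lipschitz_equidistributing[of 0]) (simp_all add: arctan_lipschitz_def)
  have "Int_stable (range (atMost :: real \<Rightarrow> _))"
  proof (intro Int_stableI)
    fix a b assume "a \<in> range (atMost :: real \<Rightarrow> _)" "b \<in> range (atMost :: real \<Rightarrow> _)"
    then obtain s t :: real where "a = {..s}" "b = {..t}" by auto
    then have "a \<inter> b = {..min s t}" by auto
    then show "a \<inter> b \<in> range atMost" by auto
  qed
  moreover have "range atMost \<subseteq> Pow (UNIV :: real set)" by simp
  moreover have "A \<in> sigma_sets UNIV (range atMost)"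
    using assms unfolding borel_eq_atMost by simp
  ultimately show ?thesis
  proof (induction rule: sigma_sets_induct_disjoint)
    case (basic A)
    then show ?case using equidistributing_atMost by auto
  next
    case empty
    show ?case using equidistributing_linear[OF one one, of 0 0] by simp
  next
    case (compl A)
    have "(indicator (UNIV - A) :: real \<Rightarrow> real) = (\<lambda>x. 1 * 1 + (-1) * indicator A x)"
      by (auto simp: indicator_def)
    then show ?case using equidistributing_linear[OF one compl.IH, of 1 "-1"] by simp
  next
    case (union A)
    have sets: "A i \<in> sets borel" for i
      using union.hyps unfolding borel_eq_atMost by auto
    have part: "equidistributing (indicator (\<Union>i<n. A i))" for n
    proof (induction n)
      case 0
      show ?case using equidistributing_linear[OF one one, of 0 0] by simp
    next
      case (Suc n)
      have "A i \<inter> A n = {}" if "i < n" for i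
        by (rule disjoint_family_onD[OF union.hyps(1)]) (use that in auto)
      then have "(\<Union>i<n. A i) \<inter> A n = {}" by blast
      then have "(indicator (\<Union>i<Suc n. A i) :: real \<Rightarrow> real) = (\<lambda>x. 1 * indicator (\<Union>i<n. A i) x + 1 * indicator (A n) x)"
        by (auto simp: indicator_def lessThan_Suc fun_eq_iff)
      then show ?case using equidistributing_linear[OF Suc union.IH, of 1 1 n] by simp
    qed
    show ?case
    proof (rule equidistributing_dominated_limit[OF part])
      show "integrable cauchy_measure (indicator (\<Union>i. A i) :: real \<Rightarrow> real)"
        using sets by (intro cauchy.integrable_const_bound[of _ 1]) (auto simp: indicator_def)
      show "(\<lambda>n. indicator (\<Union>i<n. A i) x :: real) \<longlonglongrightarrow> indicator (\<Union>i. A i) x" for x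
        by (rule LIMSEQ_indicator_UN)
      show "\<bar>indicator (\<Union>i<n. A i) x :: real\<bar> \<le> 1" for n x by (simp add: indicator_def)
    qed simp
  qed
qed

theorem integrable_imp_equidistributing:
  fixes w :: "real \<Rightarrow> real"
  assumes "integrable cauchy_measure w"
  shows "equidistributing w"
  using assms
proof (induction rule: integrable_induct)
  case (base A c)
  then have "equidistributing (indicator A)" by (intro equidistributing_indicator) simp
  from equidistributing_linear[OF this this, of c 0] show ?case by (simp add: mult.commute)
next
  case (add f g)
  then show ?case using equidistributing_linear[of f g 1 1] by simp
next
  case (lim f s)
  show ?case
    by (rule equidistributing_dominated_limit[OF lim.IH, where b = "\<lambda>x. 2 * \<bar>f x\<bar>"]) (use lim in auto)
qed

lemma transfer_exact:
  fixes w :: "real \<Rightarrow> real"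
  assumes "integrable cauchy_measure w" "(\<integral>x. w x \<partial>cauchy_measure) = 0"
  shows "(\<lambda>p. \<integral>x. \<bar>(cauchy.transfer ^^ p) w x\<bar> \<partial>cauchy_measure) \<longlonglongrightarrow> 0"
  using integrable_imp_equidistributing[OF assms(1)] assms(2) by (simp add: equidistributing_def)

section \<open>Decay of the transfer operator on the Boole class\<close>

lemma one_sided_derivative_local_bound:
  fixes h :: "real \<Rightarrow> real"
  assumes "(h has_real_derivative l) (at x within S)" "\<bar>l\<bar> \<le> B" "0 < e"
  obtains d where "0 < d" "\<And>y. y \<in> S \<Longrightarrow> \<bar>y - x\<bar> < d \<Longrightarrow> \<bar>h y - h x\<bar> \<le> (B + e) * \<bar>y - x\<bar>"
proof -
  have "((\<lambda>y. (h y - h x) / (y - x)) \<longlongrightarrow> l) (at x within S)"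
    using assms(1) by (simp add: has_field_derivative_iff)
  then have "\<forall>\<^sub>F y in at x within S. dist ((h y - h x) / (y - x)) l < e"
    using assms(3) by (rule tendstoD)
  then obtain d where d: "0 < d"
    "\<And>y. y \<in> S \<Longrightarrow> y \<noteq> x \<Longrightarrow> dist y x < d \<Longrightarrow> dist ((h y - h x) / (y - x)) l < e"
    unfolding eventually_at by blast
  show thesis
  proof (rule that[OF d(1)])
    fix y assume y: "y \<in> S" "\<bar>y - x\<bar> < d"
    show "\<bar>h y - h x\<bar> \<le> (B + e) * \<bar>y - x\<bar>"
    proof (cases "y = x")
      case False
      then have "\<bar>(h y - h x) / (y - x) - l\<bar> < e" using d(2)[of y] y by (simp add: dist_real_def)
      then have "\<bar>(h y - h x) / (y - x)\<bar> \<le> B + e" using assms(2) by linarith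
      then show ?thesis using False by (simp add: abs_divide divide_le_eq)
    qed simp
  qed
qed

text \<open>h may have corners, so the mean value theorem does not apply. Bisection does: with slack
  e the estimate holds on all short intervals around each point, by splitting at that point, and it
  is additive over adjacent intervals.\<close>

lemma one_sided_derivatives_imp_lipschitz:
  fixes h :: "real \<Rightarrow> real"
  assumes ab: "a \<le> b"
    and deriv: "\<And>x. a \<le> x \<Longrightarrow> x \<le> b \<Longrightarrow> \<exists>l r. (h has_real_derivative l) (at_left x) \<and>
      (h has_real_derivative r) (at_right x) \<and> max \<bar>l\<bar> \<bar>r\<bar> \<le> B"
  shows "\<bar>h b - h a\<bar> \<le> B * (b - a)"
proof (rule field_le_epsilon)
  fix \<epsilon> :: real assume \<epsilon>: "0 < \<epsilon>"
  \<comment> \<open>The slack adds up to e * (b - a) <= \<epsilon>; the 1 in the denominator covers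
    a = b.\<close>
  define e where "e = \<epsilon> / (b - a + 1)"
  have e: "0 < e" using \<epsilon> ab by (simp add: e_def)
  from ab have "a \<le> b \<longrightarrow> \<bar>h b - h a\<bar> \<le> (B + e) * (b - a)"
  proof (induction rule: Bolzano)
    case (trans p q r)
    then have "\<bar>h q - h p\<bar> \<le> (B + e) * (q - p)" "\<bar>h r - h q\<bar> \<le> (B + e) * (r - q)" by auto
    moreover have "(B + e) * (q - p) + (B + e) * (r - q) = (B + e) * (r - p)" by (simp add: algebra_simps)
    ultimately show ?case by linarith
  next
    case (local x)
    then obtain l r where l: "(h has_real_derivative l) (at_left x)" "\<bar>l\<bar> \<le> B"
      and r: "(h has_real_derivative r) (at_right x)" "\<bar>r\<bar> \<le> B"
      using deriv by fastforce
    obtain d1 where d1: "0 < d1" "\<And>y. y \<in> {..<x} \<Longrightarrow> \<bar>y - x\<bar> < d1 \<Longrightarrow> \<bar>h y - h x\<bar> \<le> (B + e) * \<bar>y - x\<bar>"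
      using one_sided_derivative_local_bound[OF l e] by blast
    obtain d2 where d2: "0 < d2" "\<And>y. y \<in> {x<..} \<Longrightarrow> \<bar>y - x\<bar> < d2 \<Longrightarrow> \<bar>h y - h x\<bar> \<le> (B + e) * \<bar>y - x\<bar>"
      using one_sided_derivative_local_bound[OF r e] by blast
    have "\<bar>h q - h p\<bar> \<le> (B + e) * (q - p)" if "p \<le> x" "x \<le> q" "q - p < min d1 d2" for p q
    proof -
      have "\<bar>h p - h x\<bar> \<le> (B + e) * (x - p)"
        using d1(2)[of p] that by (cases "p = x") auto
      moreover have "\<bar>h q - h x\<bar> \<le> (B + e) * (q - x)"
        using d2(2)[of q] that by (cases "q = x") auto
      moreover have "(B + e) * (x - p) + (B + e) * (q - x) = (B + e) * (q - p)" by (simp add: algebra_simps)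
      ultimately show ?thesis by linarith
    qed
    then show ?case using d1(1) d2(1) by (intro exI[of _ "min d1 d2"]) auto
  qed
  then have "\<bar>h b - h a\<bar> \<le> B * (b - a) + e * (b - a)" using ab by (simp add: algebra_simps)
  moreover have "e * (b - a) \<le> \<epsilon>"
  proof -
    have "e * (b - a) \<le> e * (b - a + 1)" using e by simp
    also have "\<dots> = \<epsilon>" using ab by (simp add: e_def)
    finally show ?thesis .
  qed
  ultimately show "\<bar>h b - h a\<bar> \<le> B * (b - a) + \<epsilon>" by linarith
qed

text \<open>On [-R, R] the derivative of arctan is at least 1 / (1 + R^2); this factor is the price
  of passing to the arctan metric.\<close>

lemma arctan_diff_lower_bound:
  assumes "x \<in> {-R..R}" "y \<in> {-R..R}"
  shows "\<bar>x - y\<bar> \<le> (1 + R\<^sup>2) * \<bar>arctan x - arctan y\<bar>"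
proof -
  have *: "y - x \<le> (1 + R\<^sup>2) * (arctan y - arctan x)" if "-R \<le> x" "x < y" "y \<le> R" for x y
  proof -
    have "\<exists>z>x. z < y \<and> arctan y - arctan x = (y - x) * inverse (1 + z\<^sup>2)"
      by (rule MVT2[OF that(2)]) (auto intro: DERIV_arctan)
    then obtain z where z: "x < z" "z < y" "arctan y - arctan x = (y - x) * inverse (1 + z\<^sup>2)" by blast
    have pos: "1 + z\<^sup>2 > 0" by (simp add: add_pos_nonneg)
    have "\<bar>z\<bar> \<le> \<bar>R\<bar>" using z that by (simp add: abs_le_iff)
    then have "z\<^sup>2 \<le> R\<^sup>2" by (simp add: abs_le_square_iff)
    then have "(1 + z\<^sup>2) * (arctan y - arctan x) \<le> (1 + R\<^sup>2) * (arctan y - arctan x)"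
      using that by (intro mult_right_mono) (auto simp: arctan_le_iff)
    moreover have "(1 + z\<^sup>2) * (arctan y - arctan x) = y - x" using pos z(3) by simp
    ultimately show ?thesis by simp
  qed
  consider "x < y" | "x = y" | "y < x" by linarith
  then show ?thesis
  proof cases
    case 1
    then have "arctan x < arctan y" by (simp add: arctan_less_iff)
    then show ?thesis using *[of x y] 1 assms by simp
  next
    case 3
    then have "arctan y < arctan x" by (simp add: arctan_less_iff)
    then show ?thesis using *[of y x] 3 assms by simp
  qed simp
qed

text \<open>Being monotone, arctan carries clamping to clamping, which is 1-Lipschitz.\<close>

lemma abs_arctan_clamp_diff_le:
  "\<bar>arctan (max a (min b x)) - arctan (max a (min b y))\<bar> \<le> \<bar>arctan x - arctan y\<bar>"
proof -
  have "mono arctan" by (simp add: mono_def arctan_le_iff)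
  then have eq: "arctan (max a (min b x)) = max (arctan a) (min (arctan b) (arctan x))" for x
    by (simp add: max_of_mono min_of_mono)
  show ?thesis unfolding eq by linarith
qed

text \<open>Because (1 + |x|)^2 <= 2 * (x^2 + 1), the integrand is at most a constant times
  \<open>(1 + \<bar>x\<bar>) powr (\<beta> - 2)\<close>, whose exponent is below -1.\<close>

lemma integrable_cauchy_powr:
  assumes "0 \<le> \<beta>" "\<beta> < 1"
  shows "integrable cauchy_measure (\<lambda>x. (1 + \<bar>x\<bar>) powr \<beta>)"
proof -
  define e where "e = \<beta> - 2"
  have e: "e < -1" using assms by (simp add: e_def)
  define g where "g x = indicator {0<..} x * (1 + x) powr e" for x :: real
  have "set_integrable lborel (einterval 0 \<infinity>) (\<lambda>x::real. (1 + x) powr e)"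
  proof (rule interval_integral_FTC_nonneg(1))
    fix x :: real assume "0 < ereal x"
    then have x: "0 < x" by (simp add: zero_ereal_def)
    show "DERIV (\<lambda>x. (1 + x) powr (e + 1) / (e + 1)) x :> (1 + x) powr e"
      using x e by (auto intro!: derivative_eq_intros)
    show "isCont (\<lambda>x. (1 + x) powr e) x"
      using x by (intro continuous_intros) auto
  next
    have "((\<lambda>x. (1 + x) powr (e + 1) / (e + 1)) \<longlongrightarrow> (1 + 0) powr (e + 1) / (e + 1)) (at_right 0)"
      using e by (intro tendsto_intros) auto
    then show "(((\<lambda>x. (1 + x) powr (e + 1) / (e + 1)) \<circ> real_of_ereal) \<longlongrightarrow> 1 / (e + 1)) (at_right 0)"
      unfolding zero_ereal_def ereal_tendsto_simps by simp
    have "filterlim (\<lambda>x::real. 1 + x) at_top at_top" by real_asymp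
    then have "((\<lambda>x::real. (1 + x) powr (e + 1)) \<longlongrightarrow> 0) at_top"
      using e by (intro tendsto_neg_powr) auto
    then have "((\<lambda>x::real. (1 + x) powr (e + 1) / (e + 1)) \<longlongrightarrow> 0 / (e + 1)) at_top"
      using e by (intro tendsto_intros) auto
    then show "(((\<lambda>x. (1 + x) powr (e + 1) / (e + 1)) \<circ> real_of_ereal) \<longlongrightarrow> 0) (at_left \<infinity>)"
      unfolding ereal_tendsto_simps by simp
  qed auto
  moreover have "einterval 0 \<infinity> = {0::real<..}" by (auto simp: einterval_def zero_ereal_def)
  ultimately have g: "integrable lborel g" by (simp add: set_integrable_def g_def[abs_def])
  then have g': "integrable lborel (\<lambda>x. g (- x))"
    using lborel_integrable_real_affine[of g "-1" 0] by simp
  have "integrable lborel (\<lambda>x. (1 / (pi * (x\<^sup>2 + 1))) *\<^sub>R (1 + \<bar>x\<bar>) powr \<beta>)"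
  proof (rule integrable_cong_AE_imp[OF Bochner_Integration.integrable_bound])
    show "integrable lborel (\<lambda>x. 2 / pi * (g x + g (- x)))" using g g' by simp
    show "(\<lambda>x. (1 / (pi * (x\<^sup>2 + 1))) *\<^sub>R (1 + \<bar>x\<bar>) powr \<beta>) \<in> borel_measurable lborel" by measurable
    \<comment> \<open>At 0 both \<open>g x\<close> and \<open>g (- x)\<close> vanish, so that point
      is left out.\<close>
    have "AE x::real in lborel. x \<noteq> 0" by (rule AE_lborel_singleton)
    then show "AE x in lborel. norm ((1 / (pi * (x\<^sup>2 + 1))) *\<^sub>R (1 + \<bar>x\<bar>) powr \<beta>) \<le> norm (2 / pi * (g x + g (- x)))"
    proof eventually_elim
      case (elim x)
      have "g x + g (- x) = (1 + \<bar>x\<bar>) powr e" using elim by (auto simp: g_def indicator_def)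
      also have "\<dots> = (1 + \<bar>x\<bar>) powr \<beta> / (1 + \<bar>x\<bar>)\<^sup>2"
        by (simp add: e_def powr_diff)
      finally have g_eq: "g x + g (- x) = (1 + \<bar>x\<bar>) powr \<beta> / (1 + \<bar>x\<bar>)\<^sup>2" .
      have pos: "0 < x\<^sup>2 + 1" by (simp add: add_nonneg_pos)
      have "(1 + \<bar>x\<bar>)\<^sup>2 \<le> 2 * (x\<^sup>2 + 1)"
        using zero_le_power2[of "\<bar>x\<bar> - 1"] by (simp add: power2_eq_square algebra_simps)
      define p where "p = x\<^sup>2 + 1"
      have "0 < p" "(1 + \<bar>x\<bar>)\<^sup>2 \<le> 2 * p" using pos \<open>(1 + \<bar>x\<bar>)\<^sup>2 \<le> 2 * (x\<^sup>2 + 1)\<close> by (simp_all add: p_def)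
      then have "2 * (1 + \<bar>x\<bar>) powr \<beta> / (pi * (2 * p)) \<le> 2 * (1 + \<bar>x\<bar>) powr \<beta> / (pi * (1 + \<bar>x\<bar>)\<^sup>2)"
        by (intro divide_left_mono mult_left_mono) auto
      then show ?case unfolding g_eq p_def[symmetric] using \<open>0 < p\<close> by simp
    qed
  qed auto
  then show ?thesis
    unfolding cauchy_measure_def by (subst integrable_density) (auto simp: add_nonneg_nonneg)
qed

lemma boole_class_continuous:
  assumes "h \<in> boole_class"
  shows "continuous_on UNIV h"
proof -
  have "isCont h x" for x
  proof -
    obtain l r where "(h has_real_derivative l) (at_left x)" "(h has_real_derivative r) (at_right x)"
      using assms unfolding boole_class_def by fast
    then show ?thesis by (auto simp: continuous_at_split intro: DERIV_continuous)
  qed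
  then show ?thesis by (simp add: continuous_at_imp_continuous_on)
qed

text \<open>B bounds the slope in x, and 1 + R^2 converts distances on the clamped range into arctan
  distances.\<close>

lemma clamp_arctan_lipschitz:
  fixes h :: "real \<Rightarrow> real"
  assumes "0 \<le> R" "0 \<le> B"
    and deriv: "\<And>x. \<bar>x\<bar> \<le> R \<Longrightarrow> \<exists>l r. (h has_real_derivative l) (at_left x) \<and>
      (h has_real_derivative r) (at_right x) \<and> max \<bar>l\<bar> \<bar>r\<bar> \<le> B"
  shows "arctan_lipschitz (B * (1 + R\<^sup>2)) (\<lambda>x. h (max (-R) (min R x)))"
  unfolding arctan_lipschitz_def
proof (intro allI)
  fix x y
  define a b where "a = max (-R) (min R x)" and "b = max (-R) (min R y)"
  have ab: "a \<in> {-R..R}" "b \<in> {-R..R}" using assms(1) by (auto simp: a_def b_def)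
  have lip: "\<bar>h q - h p\<bar> \<le> B * (q - p)" if "p \<le> q" "p \<in> {-R..R}" "q \<in> {-R..R}" for p q
    using that by (intro one_sided_derivatives_imp_lipschitz deriv) auto
  have "\<bar>h a - h b\<bar> \<le> B * \<bar>a - b\<bar>"
    using lip[of a b] lip[of b a] ab by (cases "a \<le> b") (auto simp: abs_minus_commute)
  also have "\<dots> \<le> B * ((1 + R\<^sup>2) * \<bar>arctan a - arctan b\<bar>)"
    using assms(2) by (intro mult_left_mono arctan_diff_lower_bound ab)
  also have "\<dots> \<le> B * ((1 + R\<^sup>2) * \<bar>arctan x - arctan y\<bar>)"
    unfolding a_def b_def using assms(2) by (intro mult_left_mono abs_arctan_clamp_diff_le) auto
  finally show "\<bar>h (max (- R) (min R x)) - h (max (- R) (min R y))\<bar> \<le> B * (1 + R\<^sup>2) * \<bar>arctan x - arctan y\<bar>"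
    by (simp add: a_def b_def mult.assoc)
qed

lemma square_integral_le_integral_square:
  assumes "integrable cauchy_measure (X :: real \<Rightarrow> real)" "integrable cauchy_measure (\<lambda>x. (X x)\<^sup>2)"
  shows "(\<integral>x. X x \<partial>cauchy_measure)\<^sup>2 \<le> (\<integral>x. (X x)\<^sup>2 \<partial>cauchy_measure)"
  using cauchy.variance_eq[OF assms] cauchy.variance_positive[of X] by simp

lemma integrable_sq_if_growth:
  fixes h :: "real \<Rightarrow> real"
  assumes u: "0 \<le> u" "u < 1 / 2" and K: "0 < K"
    and growth: "\<And>x. \<bar>h x\<bar> \<le> K * (1 + \<bar>x\<bar>) powr u" and [measurable]: "h \<in> borel_measurable borel"
  shows "integrable cauchy_measure (\<lambda>x. (h x)\<^sup>2)"
proof (rule Bochner_Integration.integrable_bound)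
  show "integrable cauchy_measure (\<lambda>x. K\<^sup>2 * (1 + \<bar>x\<bar>) powr (2 * u))"
    using u by (intro integrable_mult_right integrable_cauchy_powr) auto
  have "(h x)\<^sup>2 \<le> K\<^sup>2 * (1 + \<bar>x\<bar>) powr (2 * u)" for x
  proof -
    have "(h x)\<^sup>2 \<le> (K * (1 + \<bar>x\<bar>) powr u)\<^sup>2"
      using power_mono[OF growth[of x], of 2] by simp
    also have "\<dots> = K\<^sup>2 * (1 + \<bar>x\<bar>) powr (2 * u)"
      by (simp add: power_mult_distrib powr_power mult.commute)
    finally show ?thesis .
  qed
  then show "AE x in cauchy_measure. norm ((h x)\<^sup>2) \<le> norm (K\<^sup>2 * (1 + \<bar>x\<bar>) powr (2 * u))"
    by (intro AE_I2) simp
qed simp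

text \<open>The error lives where |x| > R. There
  \<open>(1 + \<bar>x\<bar>) powr (2 * \<delta>)\<close> exceeds
  \<open>(1 + R) powr (2 * \<delta>)\<close>, so the spare exponent 2 * \<delta> of integrability is
  traded for decay in R.\<close>

lemma clamp_L2_error:
  fixes h :: "real \<Rightarrow> real"
  assumes u: "0 \<le> u" "0 < \<delta>" "2 * u + 2 * \<delta> < 1" and K: "0 < K" and R: "0 \<le> R"
    and growth: "\<And>x. \<bar>h x\<bar> \<le> K * (1 + \<bar>x\<bar>) powr u" and [measurable]: "h \<in> borel_measurable borel"
  defines "d \<equiv> \<lambda>x. h x - h (max (-R) (min R x))"
  shows "integrable cauchy_measure (\<lambda>x. (d x)\<^sup>2)"
    and "(\<integral>x. (d x)\<^sup>2 \<partial>cauchy_measure) \<le>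
      4 * K\<^sup>2 * (1 + R) powr (- 2 * \<delta>) * (\<integral>x. (1 + \<bar>x\<bar>) powr (2 * u + 2 * \<delta>) \<partial>cauchy_measure)"
proof -
  let ?m = "\<lambda>x::real. 4 * K\<^sup>2 * (1 + R) powr (- 2 * \<delta>) * (1 + \<bar>x\<bar>) powr (2 * u + 2 * \<delta>)"
  have m: "integrable cauchy_measure ?m"
    using u by (intro integrable_mult_right integrable_cauchy_powr) auto
  have bound: "(d x)\<^sup>2 \<le> ?m x" for x
  proof (cases "\<bar>x\<bar> \<le> R")
    case True
    then have "max (-R) (min R x) = x" by linarith
    then have "d x = 0" by (simp add: d_def)
    then show ?thesis by simp
  next
    case False
    have "\<bar>max (-R) (min R x)\<bar> \<le> \<bar>x\<bar>" using R by (auto simp: abs_le_iff min_def max_def)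
    then have "(1 + \<bar>max (-R) (min R x)\<bar>) powr u \<le> (1 + \<bar>x\<bar>) powr u"
      using u by (intro powr_mono2) auto
    then have "K * (1 + \<bar>max (-R) (min R x)\<bar>) powr u \<le> K * (1 + \<bar>x\<bar>) powr u"
      using K by (intro mult_left_mono) auto
    then have "\<bar>d x\<bar> \<le> 2 * K * (1 + \<bar>x\<bar>) powr u"
      using growth[of x] growth[of "max (-R) (min R x)"] unfolding d_def by linarith
    then have "(d x)\<^sup>2 \<le> (2 * K * (1 + \<bar>x\<bar>) powr u)\<^sup>2"
      using power_mono[of "\<bar>d x\<bar>" _ 2] by simp
    also have "\<dots> = 4 * K\<^sup>2 * (1 + \<bar>x\<bar>) powr (2 * u)"
      by (simp add: power_mult_distrib powr_power mult.commute)
    also have "\<dots> \<le> 4 * K\<^sup>2 * ((1 + R) powr (- 2 * \<delta>) * (1 + \<bar>x\<bar>) powr (2 * u + 2 * \<delta>))"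
    proof (intro mult_left_mono)
      have "1 = (1 + R) powr (- 2 * \<delta>) * (1 + R) powr (2 * \<delta>)"
        using R by (simp flip: powr_add)
      also have "\<dots> \<le> (1 + R) powr (- 2 * \<delta>) * (1 + \<bar>x\<bar>) powr (2 * \<delta>)"
        using False R u by (intro mult_left_mono powr_mono2) auto
      finally have "1 * (1 + \<bar>x\<bar>) powr (2 * u) \<le> (1 + R) powr (- 2 * \<delta>) * (1 + \<bar>x\<bar>) powr (2 * \<delta>) * (1 + \<bar>x\<bar>) powr (2 * u)"
        by (intro mult_right_mono) auto
      then show "(1 + \<bar>x\<bar>) powr (2 * u) \<le> (1 + R) powr (- 2 * \<delta>) * (1 + \<bar>x\<bar>) powr (2 * u + 2 * \<delta>)"
        by (simp add: powr_add mult_ac)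
    qed simp
    finally show ?thesis by (simp add: mult.assoc)
  qed
  have [measurable]: "d \<in> borel_measurable borel" unfolding d_def by measurable
  show i: "integrable cauchy_measure (\<lambda>x. (d x)\<^sup>2)"
    by (rule Bochner_Integration.integrable_bound[OF m]) (auto intro!: AE_I2 order_trans[OF bound])
  have "(\<integral>x. (d x)\<^sup>2 \<partial>cauchy_measure) \<le> (\<integral>x. ?m x \<partial>cauchy_measure)"
    by (intro integral_mono i m bound)
  then show "(\<integral>x. (d x)\<^sup>2 \<partial>cauchy_measure) \<le>
      4 * K\<^sup>2 * (1 + R) powr (- 2 * \<delta>) * (\<integral>x. (1 + \<bar>x\<bar>) powr (2 * u + 2 * \<delta>) \<partial>cauchy_measure)"
    by simp
qed

text \<open>Write h - \<mu>(h) as (h - g) + (g - \<mu>(g)) + (\<mu>(g) - \<mu>(h)). The transfer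
  contracts the first term in L2, flattens the second uniformly and fixes the constant, which is at
  most the L2 norm of h - g. The 2 counts the first and last term; the 3 comes from squaring a sum
  of three.\<close>

lemma transfer_L2_bound_via_clamp:
  fixes h :: "real \<Rightarrow> real"
  assumes [measurable]: "h \<in> borel_measurable borel" and h2: "integrable cauchy_measure (\<lambda>x. (h x)\<^sup>2)"
    and g: "arctan_lipschitz L g" "0 \<le> L" and [measurable]: "g \<in> borel_measurable borel"
    and d2: "integrable cauchy_measure (\<lambda>x. (h x - g x)\<^sup>2)"
  shows "(\<integral>x. ((cauchy.transfer ^^ n) (\<lambda>x. h x - cauchy_mean h) x)\<^sup>2 \<partial>cauchy_measure)
    \<le> 3 * (2 * (\<integral>x. (h x - g x)\<^sup>2 \<partial>cauchy_measure) + (L * pi / 2 ^ n)\<^sup>2)"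
proof -
  let ?I = "\<lambda>w. \<integral>x. w x \<partial>cauchy_measure"
  let ?L = "cauchy.transfer ^^ n"
  let ?d = "\<lambda>x. h x - g x"
  have h1: "integrable cauchy_measure h" by (rule cauchy.square_integrable_imp_integrable[OF _ h2]) simp
  have g1: "integrable cauchy_measure g" by (rule arctan_lipschitz_integrable[OF g]) simp
  have d1: "integrable cauchy_measure ?d" using h1 g1 by simp
  have Ld: "integrable cauchy_measure (\<lambda>x. (?L ?d x)\<^sup>2)" "?I (\<lambda>x. (?L ?d x)\<^sup>2) \<le> ?I (\<lambda>x. (?d x)\<^sup>2)"
    using cauchy.transfer_L2_contract[of ?d n] d2 by auto
  have c: "(?I g - ?I h)\<^sup>2 \<le> ?I (\<lambda>x. (?d x)\<^sup>2)"
    using square_integral_le_integral_square[OF d1 d2] h1 g1 by (simp add: power2_commute)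
  have f2: "integrable cauchy_measure (\<lambda>x. (h x - cauchy_mean h)\<^sup>2)"
    using h2 by (intro square_integrable_diff) auto
  have "?I (\<lambda>x. (?L (\<lambda>x. h x - cauchy_mean h) x)\<^sup>2) \<le> ?I (\<lambda>x. 3 * ((?L ?d x)\<^sup>2 + (L * pi / 2 ^ n)\<^sup>2 + (?I g - ?I h)\<^sup>2))"
  proof (rule integral_mono)
    show "integrable cauchy_measure (\<lambda>x. (?L (\<lambda>x. h x - cauchy_mean h) x)\<^sup>2)"
      using cauchy.transfer_L2_contract[of "\<lambda>x. h x - cauchy_mean h" n] f2 by auto
    show "integrable cauchy_measure (\<lambda>x. 3 * ((?L ?d x)\<^sup>2 + (L * pi / 2 ^ n)\<^sup>2 + (?I g - ?I h)\<^sup>2))"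
      using Ld by (intro integrable_mult_right Bochner_Integration.integrable_add cauchy.integrable_const)
    fix x
    have split: "?L (\<lambda>x. h x - cauchy_mean h) x = ?L ?d x + (?L g x - ?I g) + (?I g - ?I h)"
      by (simp add: half_sum_iterate_diff half_sum_iterate_const cauchy_mean_def)
    have three: "(a + b + c)\<^sup>2 \<le> 3 * (a\<^sup>2 + b\<^sup>2 + c\<^sup>2)" for a b c :: real
      using zero_le_power2[of "a - b"] zero_le_power2[of "b - c"] zero_le_power2[of "a - c"]
      by (simp add: power2_eq_square algebra_simps)
    have "(?L g x - ?I g)\<^sup>2 \<le> (L * pi / 2 ^ n)\<^sup>2"
      using power_mono[OF arctan_lipschitz_transfer_uniform[OF g, of n x], of 2] by simp
    then show "(?L (\<lambda>x. h x - cauchy_mean h) x)\<^sup>2 \<le> 3 * ((?L ?d x)\<^sup>2 + (L * pi / 2 ^ n)\<^sup>2 + (?I g - ?I h)\<^sup>2)"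
      unfolding split by (intro order_trans[OF three] mult_left_mono add_mono order.refl) auto
  qed
  also have "\<dots> = 3 * (?I (\<lambda>x. (?L ?d x)\<^sup>2) + (L * pi / 2 ^ n)\<^sup>2 + (?I g - ?I h)\<^sup>2)"
    using Ld by simp
  also have "\<dots> \<le> 3 * (2 * ?I (\<lambda>x. (?d x)\<^sup>2) + (L * pi / 2 ^ n)\<^sup>2)" using Ld c by simp
  finally show ?thesis .
qed

text \<open>Clamping at level \<open>R\<close> costs \<open>R\<^sup>-\<^sup>\<delta>\<close> in \<open>L\<^sup>2\<close> and gives a Lipschitz function with constant
  polynomial in \<open>R\<close>; a level \<open>R\<close> growing exponentially in \<open>n\<close> at a small rate balances the two.\<close>

lemma boole_class_transfer_decay:
  assumes "h \<in> boole_class"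
  obtains C q where "0 < q" "q < 1" "integrable cauchy_measure (\<lambda>x. (h x)\<^sup>2)"
    "\<And>n. (\<integral>x. ((cauchy.transfer ^^ n) (\<lambda>x. h x - cauchy_mean h) x)\<^sup>2 \<partial>cauchy_measure) \<le> C * q ^ n"
proof -
  obtain u v K where uv: "0 \<le> u" "0 \<le> v" "u * (2 + v) < 1" and K: "0 < K"
    and growth: "\<And>x. \<bar>h x\<bar> \<le> K * (1 + \<bar>x\<bar>) powr u"
    and deriv: "\<And>x. \<exists>l r. (h has_real_derivative l) (at_left x) \<and> (h has_real_derivative r) (at_right x) \<and>
      max \<bar>l\<bar> \<bar>r\<bar> \<le> K * (1 + \<bar>x\<bar>) powr v"
    using assms unfolding boole_class_def by blast
  have hm [measurable]: "h \<in> borel_measurable borel"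
    by (rule borel_measurable_continuous_onI[OF boole_class_continuous[OF assms]])
  have "u * 2 \<le> u * (2 + v)" using uv by (intro mult_left_mono) auto
  then have u: "u < 1 / 2" using uv by simp
  \<comment> \<open>Half of the gap 1 - 2 * u is spent: the exponent 2 * u + 2 * \<delta> is the
    midpoint of 2 * u and 1.\<close>
  define \<delta> where "\<delta> = (1 - 2 * u) / 4"
  have \<delta>: "0 < \<delta>" "2 * u + 2 * \<delta> < 1" "\<delta> < 1" using u uv by (auto simp: \<delta>_def field_simps)
  have h2: "integrable cauchy_measure (\<lambda>x. (h x)\<^sup>2)"
    by (rule integrable_sq_if_growth[OF uv(1) u K growth hm])
  \<comment> \<open>Chosen so that \<open>\<rho> powr (- 2 * \<delta>) = q ^ n\<close> for the
    clamping level \<rho> below.\<close>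
  define q where "q = 2 powr (- \<delta> / (v + 2))"
  have q: "0 < q" "q < 1" using \<delta> uv by (simp_all add: q_def powr_less_one divide_neg_pos)
  \<comment> \<open>This lets q^n absorb the Lipschitz contribution, which is of order
    (1/2)^n.\<close>
  have q_half: "1 / 2 \<le> q"
  proof -
    have "\<delta> / (v + 2) \<le> 1" using \<delta> uv by simp
    then have "2 powr (-1 :: real) \<le> q" unfolding q_def by (intro powr_mono) auto
    then show ?thesis by (simp add: powr_minus)
  qed
  define B where "B = (\<integral>x. (1 + \<bar>x\<bar>) powr (2 * u + 2 * \<delta>) \<partial>cauchy_measure)"
  define C where "C = 3 * (2 * (4 * K\<^sup>2 * B) + (K * pi)\<^sup>2)"
  have "(\<integral>x. ((cauchy.transfer ^^ n) (\<lambda>x. h x - cauchy_mean h) x)\<^sup>2 \<partial>cauchy_measure) \<le> C * q ^ n" for n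
  proof -
    \<comment> \<open>The Lipschitz constant at this level is at most
      \<open>K * \<rho> powr (v + 2) = K * 2 powr (n / 2)\<close>, and dividing it by 2^n still
      leaves \<open>2 powr (- n / 2)\<close>. Taking R = \<rho> - 1 makes 1 + R equal to
      \<rho>.\<close>
    define \<rho> where "\<rho> = 2 powr (n / (2 * (v + 2)))"
    define R where "R = \<rho> - 1"
    have \<rho>: "1 \<le> \<rho>" using uv by (simp add: \<rho>_def ge_one_powr_ge_zero)
    then have R: "0 \<le> R" "1 + R = \<rho>" by (simp_all add: R_def)
    define g where "g x = h (max (-R) (min R x))" for x
    define L where "L = K * \<rho> powr v * (1 + R\<^sup>2)"
    have gm [measurable]: "g \<in> borel_measurable borel" unfolding g_def by measurable
    have L0: "0 \<le> L" using K by (simp add: L_def)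
    have lip: "arctan_lipschitz L g"
      unfolding L_def g_def
    proof (rule clamp_arctan_lipschitz)
      fix x assume x: "\<bar>x\<bar> \<le> R"
      have "(1 + \<bar>x\<bar>) powr v \<le> \<rho> powr v" using x uv by (intro powr_mono2) (auto simp: R_def)
      then have "K * (1 + \<bar>x\<bar>) powr v \<le> K * \<rho> powr v" using K by simp
      then show "\<exists>l r. (h has_real_derivative l) (at_left x) \<and> (h has_real_derivative r) (at_right x) \<and>
        max \<bar>l\<bar> \<bar>r\<bar> \<le> K * \<rho> powr v"
        using deriv[of x] by (meson order_trans)
    qed (use R K in auto)
    have tail: "integrable cauchy_measure (\<lambda>x. (h x - g x)\<^sup>2)"
      "(\<integral>x. (h x - g x)\<^sup>2 \<partial>cauchy_measure) \<le> 4 * K\<^sup>2 * \<rho> powr (- 2 * \<delta>) * B"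
      using clamp_L2_error[OF uv(1) \<delta>(1,2) K R(1) growth hm] by (simp_all add: g_def R B_def)
    have \<rho>q: "\<rho> powr (- 2 * \<delta>) = q ^ n"
    proof -
      have "\<rho> powr (- 2 * \<delta>) = 2 powr (- \<delta> / (v + 2) * n)"
      proof -
        have "real n / (2 * w) * (- 2 * \<delta>) = - \<delta> / w * n" for w :: real by simp
        then show ?thesis unfolding \<rho>_def powr_powr by (rule arg_cong)
      qed
      also have "\<dots> = q powr n" by (simp only: q_def powr_powr)
      finally show ?thesis using q by (simp add: powr_realpow)
    qed
    have "L * pi / 2 ^ n \<le> K * pi * 2 powr (- real n / 2)"
    proof -
      have "1 + R\<^sup>2 \<le> \<rho>\<^sup>2" using R by (auto simp flip: R(2) simp: power2_eq_square algebra_simps)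
      then have "L \<le> K * \<rho> powr v * \<rho>\<^sup>2" unfolding L_def using K by (intro mult_left_mono) auto
      also have "\<dots> = K * \<rho> powr (v + 2)" using \<rho> by (simp add: powr_add)
      also have "\<rho> powr (v + 2) = 2 powr (n / 2)"
      proof -
        have "real n / (2 * w) * w = n / 2" if "w \<noteq> 0" for w :: real using that by simp
        then show ?thesis unfolding \<rho>_def powr_powr by (rule arg_cong) (use uv in simp)
      qed
      finally have "L * pi / 2 ^ n \<le> K * 2 powr (n / 2) * pi / 2 ^ n"
        by (intro divide_right_mono mult_right_mono) auto
      also have "\<dots> = K * pi * (2 powr (n / 2) / 2 powr n)" by (simp add: powr_realpow)
      also have "2 powr (n / 2) / 2 powr n = 2 powr (- real n / 2)" by (simp flip: powr_diff)
      finally show ?thesis .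
    qed
    then have "(L * pi / 2 ^ n)\<^sup>2 \<le> (K * pi * 2 powr (- real n / 2))\<^sup>2"
      using L0 by (intro power_mono) auto
    also have "\<dots> = (K * pi)\<^sup>2 * (1 / 2) ^ n"
    proof -
      have "(2 powr (- real n / 2))\<^sup>2 = 2 powr (- real n)"
        by (simp only: power2_eq_square powr_add[symmetric]) simp
      also have "\<dots> = (1 / 2) ^ n"
        by (simp add: powr_minus powr_realpow power_one_over inverse_eq_divide)
      finally show ?thesis by (simp only: power_mult_distrib)
    qed
    also have "\<dots> \<le> (K * pi)\<^sup>2 * q ^ n" using q_half by (intro mult_left_mono power_mono) auto
    finally have "(L * pi / 2 ^ n)\<^sup>2 \<le> (K * pi)\<^sup>2 * q ^ n" .
    moreover have "(\<integral>x. (h x - g x)\<^sup>2 \<partial>cauchy_measure) \<le> 4 * K\<^sup>2 * B * q ^ n"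
      using tail(2) unfolding \<rho>q by (simp add: mult_ac)
    ultimately have "3 * (2 * (\<integral>x. (h x - g x)\<^sup>2 \<partial>cauchy_measure) + (L * pi / 2 ^ n)\<^sup>2) \<le> C * q ^ n"
      by (simp add: C_def algebra_simps)
    with transfer_L2_bound_via_clamp[OF hm h2 lip L0 gm tail(1), of n] show ?thesis by linarith
  qed
  with q h2 that show thesis by blast
qed

section \<open>The central limit theorem for the Boole map\<close>

lemma cdf_std_normal: "cdf std_normal_distribution x = std_normal_cdf x"
proof -
  have "cdf std_normal_distribution x = (\<integral>y. indicator {..x} y \<partial>std_normal_distribution)"
    by (simp add: cdf_def)
  also have "\<dots> = (\<integral>y. std_normal_density y *\<^sub>R indicator {..x} y \<partial>lborel)"
    by (intro integral_density) (auto simp: normal_density_nonneg)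
  also have "\<dots> = std_normal_cdf x"
    unfolding std_normal_cdf_def set_lebesgue_integral_def
    by (intro Bochner_Integration.integral_cong) (auto simp: std_normal_density_def mult.commute)
  finally show ?thesis .
qed

lemma isCont_cdf_std_normal: "isCont (cdf std_normal_distribution) x"
proof -
  interpret real_distribution std_normal_distribution by (rule real_dist_normal_dist)
  have "AE y in lborel. y \<noteq> x" by (rule AE_lborel_singleton)
  then have "AE y in std_normal_distribution. y \<noteq> x"
    by (subst AE_density) auto
  then have "emeasure std_normal_distribution {x} = 0"
    by (subst (asm) AE_iff_measurable[of "{x}"]) auto
  then show ?thesis unfolding isCont_cdf by (simp add: measure_def)
qed

text \<open>Levy continuity gives convergence of distribution functions at the continuity points of
  the limit; the normal law has no atoms, so this is every x.\<close>

lemma (in prob_space) char_limit_imp_cdf_limit: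
  fixes X :: "nat \<Rightarrow> 'a \<Rightarrow> real"
  assumes [measurable]: "\<And>n. X n \<in> borel_measurable M"
    and lim: "\<And>t. (\<lambda>n. \<integral>y. iexp (t * X n y) \<partial>M) \<longlonglongrightarrow> of_real (exp (- (t\<^sup>2) / 2))"
  shows "(\<lambda>n. prob {y \<in> space M. X n y \<le> x}) \<longlonglongrightarrow> std_normal_cdf x"
proof -
  have "weak_conv_m (\<lambda>n. distr M borel (X n)) std_normal_distribution"
  proof (rule levy_continuity[OF real_distribution_distr real_dist_normal_dist])
    show "(\<lambda>n. char (distr M borel (X n)) t) \<longlonglongrightarrow> char std_normal_distribution t" for t
      using lim[of t] by (simp add: char_def integral_distr char_std_normal_distribution)
  qed simp
  then have "(\<lambda>n. cdf (distr M borel (X n)) x) \<longlonglongrightarrow> cdf std_normal_distribution x"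
    using isCont_cdf_std_normal by (simp add: weak_conv_m_def weak_conv_def)
  moreover have "cdf (distr M borel (X n)) x = prob {y \<in> space M. X n y \<le> x}" for n
    unfolding cdf_def by (subst measure_distr) (auto intro!: arg_cong[where f = prob])
  ultimately show ?thesis by (simp add: cdf_std_normal)
qed

theorem proposition2p11:
  fixes h :: "real \<Rightarrow> real"
  assumes "h \<in> boole_class"
    and "\<not> cohomologous_to_constant h"
  shows "convergent (normalized_variance h) \<and> 0 < asymptotic_variance h \<and>
    (\<forall>x. (\<lambda>n. measure cauchy_measure
                 {y \<in> space cauchy_measure.
                    (birkhoff_sum n h y - real n * cauchy_mean h)
                      / (asymptotic_sd h * sqrt (real n)) \<le> x}
               - std_normal_cdf x) \<longlonglongrightarrow> 0)"
proof -
  define f where "f x = h x - cauchy_mean h" for x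
  obtain C q where q: "0 < q" "q < 1" and h2: "integrable cauchy_measure (\<lambda>x. (h x)\<^sup>2)"
    and decay: "\<And>n. (\<integral>x. ((cauchy.transfer ^^ n) f x)\<^sup>2 \<partial>cauchy_measure) \<le> C * q ^ n"
    using boole_class_transfer_decay[OF assms(1)] unfolding f_def by metis
  have hm: "h \<in> borel_measurable borel"
    by (rule borel_measurable_continuous_onI[OF boole_class_continuous[OF assms(1)]])
  then have fm [measurable]: "f \<in> borel_measurable cauchy_measure" by (simp add: f_def[abs_def])
  have f2: "integrable cauchy_measure (\<lambda>x. (f x)\<^sup>2)"
    unfolding f_def using hm h2 by (intro square_integrable_diff) auto
  have not_cob: "\<not> (AE x in cauchy_measure. f x = g (boole_map x) - g x)"
    if g: "g \<in> borel_measurable cauchy_measure" "integrable cauchy_measure (\<lambda>x. (g x)\<^sup>2)" for g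
  proof
    assume "AE x in cauchy_measure. f x = g (boole_map x) - g x"
    \<comment> \<open>The mean of h serves as the constant in the cohomology relation.\<close>
    then have "AE x in cauchy_measure. h x = g (boole_map x) - g x + cauchy_mean h"
      by eventually_elim (simp add: f_def)
    with g assms(2) show False unfolding cohomologous_to_constant_def by blast
  qed
  obtain v where v: "0 < v"
    and var: "(\<lambda>n. \<integral>x. (cauchy.ergodic_sum f n x / sqrt n)\<^sup>2 \<partial>cauchy_measure) \<longlonglongrightarrow> v"
    and char: "\<And>t. (\<lambda>n. \<integral>x. iexp (t / sqrt n * cauchy.ergodic_sum f n x) \<partial>cauchy_measure) \<longlonglongrightarrow> of_real (exp (- (t\<^sup>2 * v / 2)))"
    using cauchy.gordin_central_limit[OF fm f2 q decay transfer_exact not_cob] by blast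
  have sum_eq: "birkhoff_sum n h x - real n * cauchy_mean h = cauchy.ergodic_sum f n x" for n x
    by (simp add: birkhoff_sum_def cauchy.ergodic_sum_def f_def sum_subtractf)
  have var': "normalized_variance h \<longlonglongrightarrow> v"
    using var unfolding normalized_variance_def sum_eq .
  then have av: "asymptotic_variance h = v" by (simp add: asymptotic_variance_def limI)
  have "(\<lambda>n. cauchy.prob {y \<in> space cauchy_measure. cauchy.ergodic_sum f n y / (sqrt v * sqrt (real n)) \<le> x})
    \<longlonglongrightarrow> std_normal_cdf x" for x
  proof (rule cauchy.char_limit_imp_cdf_limit)
    show "(\<lambda>y. cauchy.ergodic_sum f n y / (sqrt v * sqrt (real n))) \<in> borel_measurable cauchy_measure" for n
      by measurable
    fix t :: real
    \<comment> \<open>Dividing the sums by sqrt v amounts to evaluating the limit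
      \<open>char\<close> at t / sqrt v.\<close>
    have "(t / sqrt v)\<^sup>2 * v / 2 = t\<^sup>2 / 2" using v by (simp add: power_divide)
    then show "(\<lambda>n. \<integral>y. iexp (t * (cauchy.ergodic_sum f n y / (sqrt v * sqrt (real n)))) \<partial>cauchy_measure)
      \<longlonglongrightarrow> of_real (exp (- (t\<^sup>2) / 2))"
      using char[of "t / sqrt v"] by simp
  qed
  then show ?thesis
    using var' v LIM_zero by (auto simp: convergent_def av asymptotic_sd_def sum_eq)
qed

end
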